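(* Let $X\subset\mathbb{T}_N$ be a $\mathbb{K}$-subscheme, let $\tau,t:\Gamma\to\mathbb{K}^*$ be two sections of the valuation, and let $\mathscr{C}$ be a polyhedral complex supported on $\operatorname{Trop}(X)$ induced by a projective compactification of $\mathbb{T}_N$. Let $\mathscr{M}(\mathscr{C})$ be the set of minimal faces of $\mathscr{C}$, and for each $\sigma\in\mathscr{M}(\mathscr{C})$ choose a point $w_\sigma\in\sigma$ and set $a_\sigma:=\overline{\alpha^{w_\sigma}}\in\mathbb{T}_N(\Bbbk)$, where $\alpha^{w}\in\mathbb{T}_N(R)$ is the element $\alpha^w(m)=t(\langle m,w\rangle)/\tau(\langle m,w\rangle)$, $m\in M$. If $w\in\operatorname{Trop}(X)$, then $$X_{w,\tau}\;=\;a_\sigma\cdot X_{w,t},$$ where $\sigma$ is a minimal face of the face of $\mathscr{C}$ containing $w$ in its relative interior. If $\rho\in\mathscr{C}$, then the elements $\{a_\sigma\mid\sigma\subset\rho\text{ and }\sigma\in\mathscr{M}(\mathscr{C})\}$ lie in a single coset of $\mathbb{T}_{\langle\rho\rangle}(\Bbbk)$ in $\mathbb{T}_N(\Bbbk)$.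
   Context: Valued field. $\mathbb{K}$ is an algebraically closed field with a non-trivial non-archimedean valuation $\nu:\mathbb{K}^*\to\Gamma$, surjective onto a divisible totally ordered abelian group $\Gamma$ (not necessarily a subgroup of $\mathbb{R}$). $R=\{x:\nu(x)\ge 0\}$, $\mathfrak m=\{x:\nu(x)>0\}$, and $\Bbbk=R/\mathfrak m$ is the residue field; the bar denotes reduction, $R\to\Bbbk$ and $\mathbb{T}_N(R)\to\mathbb{T}_N(\Bbbk)$. A section of the valuation is a group homomorphism $\tau:\Gamma\to\mathbb{K}^*$ with $\nu\circ\tau=\mathrm{id}$ (these exist). Tori. $N$ is a finitely generated free abelian group of rank $n$, $M=\operatorname{Hom}(N,\mathbb{Z})$, with pairing $\langle\cdot,\cdot\rangle$. $\mathbb{T}_N=\operatorname{Spec}\mathbb{Z}[M]$, so $\mathbb{T}_N(A)=\operatorname{Hom}(M,A^* )$ for a ring $A$; $\xi^{m}$ is the monomial of $m\in M$. $\Gamma_N=\Gamma\otimes_{\mathbb Z}N$; $\operatorname{trop}:\mathbb{T}_N(\mathbb{K})\to\Gamma_N$ is determined by $\langle m,\operatorname{trop}(x)\rangle=\nu(x(m))$, and $\operatorname{Trop}(X)\subset\Gamma_N$ denotes the tropicalization of $X$, the image of $X(\mathbb{K})$ under $\operatorname{trop}$. A sublattice $N'\subset N$ induces $\mathbb{T}_{N'}\to\mathbb{T}_N$, a subtorus when $N'$ is saturated. Tropical reductions. Let $I\subset\mathbb{K}[M]$ be the ideal of $X$. For a section $\tau$, $w\in\Gamma_N$ and $0\ne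 f=\sum c_m\xi^m\in\mathbb{K}[M]$, put $w(f)=\min\{\nu(c_m)+\langle m,w\rangle : c_m\neq 0\}$ and $f_{w,\tau}=\sum_m\overline{c_m\,\tau(\langle m,w\rangle-w(f))}\,\xi^m\in\Bbbk[M]$. The tropical reduction $X_{w,\tau}\subset\mathbb{T}_N$ is the $\Bbbk$-subscheme defined by the ideal generated by all $f_{w,\tau}$, $0\neq f\in I$. Its $\Bbbk$-points are the reductions of $\tau^{-w}x$ for $x\in X(\mathbb{K})$ with $\operatorname{trop}(x)=w$, where $\tau^{w}(m)=\tau(\langle m,w\rangle)$. It is nonempty exactly when $w\in\operatorname{Trop}(X)$. Polyhedra. A polyhedron in $\Gamma_N$ is a finite intersection of half-spaces $\{w:\langle m,w\rangle\ge a\}$, $m\in M$, $a\in\Gamma$. A face of a polyhedron $\sigma$ is $\sigma$ or a (nonempty) intersection of $\sigma$ with a hyperplane $\{\langle m,w\rangle=a\}$ where $\sigma\subset\{\langle m,w\rangle\ge a\}$. The relative interior of $\sigma$ is $\sigma$ minus its proper faces. $\langle\sigma\rangle$ is the saturated sublattice of $N$ such that $\Gamma_{\langle\sigma\rangle}$ is the intersection of all subgroups $\{v\in\Gamma_N:\langle m,v\rangle=0\}$, $m\in M$, containing all differences of elements of $\sigma$. A polyhedral complex is a finite collection of polyhedra (its faces), closed under taking faces, any two of which are disjoint or meet in a common face; its support is their union. Minimal faces are those minimal under inclusion. The complex $\mathscr{C}$. A projective compactification $\mathbb{T}_N\subset\mathbb{P}^n$ corresponds to a basis of $M$, giving a polynomial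 subalgebra $\mathbb{K}[x_1,\dots,x_n]\subset\mathbb{K}[M]$. Let $\widetilde I\subset\mathbb{K}[x_0,\dots,x_n]$ be the homogenization of $I\cap\mathbb{K}[x_1,\dots,x_n]$. Define initial forms of elements of $\widetilde I$ at $w\in\Gamma_N$ by the same formula as $f_{w,\tau}$, with $x_0$ given weight $0$ and $x_1,\dots,x_n$ the weights determined by $w$. The Gröbner complex of $\widetilde I$ is the polyhedral complex for which $w,u$ lie in the relative interior of the same face if and only if the ideals of initial forms of $\widetilde I$ at $w$ and $u$ coincide; $\mathscr{C}$ is its subcomplex of faces contained in $\operatorname{Trop}(X)$, and its support is $\operatorname{Trop}(X)$. *)

theory Defs
  imports
    Complex_Main
    "HOL-Library.Poly_Mapping"
    "HOL-Computational_Algebra.Polynomial"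
begin

section \<open>Abelian groups as \<open>\<int>\<close>-modules\<close>

definition zmult :: "int \<Rightarrow> 'a::ab_group_add \<Rightarrow> 'a" where
  "zmult k x = (if 0 \<le> k then (\<Sum>i<nat k. x) else - (\<Sum>i<nat (- k). x))"

lemma zmult_of_nat: "zmult (int n) x = (\<Sum>i<n. x)"
  by (simp add: zmult_def)

lemma zmult_diff: "zmult (int a - int b) x = (\<Sum>i<a. x) - (\<Sum>i<b. x)"
proof (cases "b \<le> a")
  case True
  then obtain c where "a = b + c" by (metis le_add_diff_inverse)
  then show ?thesis
    by (induction c arbitrary: a) (simp_all add: zmult_def nat_add_distrib algebra_simps)
next
  case False
  then obtain c where c: "b = a + c" "c > 0" by (metis less_imp_add_positive not_le)
  have "(\<Sum>i<a + c. x) = (\<Sum>i<a. x) + (\<Sum>i<c. x)"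
    by (induction c) (simp_all add: algebra_simps)
  with c show ?thesis by (simp add: zmult_def)
qed

lemma module_zmult: "module (zmult :: int \<Rightarrow> 'a::ab_group_add \<Rightarrow> 'a)"
proof
  have sum_add_const: "(\<Sum>i<m + n. x) = (\<Sum>i<m. x) + (\<Sum>i<n. x)" for m n :: nat and x :: 'a
    by (induction n) (simp_all add: algebra_simps)
  fix k l :: int and x y :: 'a
  show "zmult k (x + y) = zmult k x + zmult k y"
    by (simp add: zmult_def sum.distrib)
  show add: "zmult (k + l) x = zmult k x + zmult l x" for k l :: int and x :: 'a
  proof -
    obtain a b where k: "k = int a - int b" by (rule int_diff_cases)
    obtain c d where l: "l = int c - int d" by (rule int_diff_cases)
    have "zmult (k + l) x = zmult (int (a + c) - int (b + d)) x"
      by (simp add: k l algebra_simps)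
    also have "\<dots> = zmult k x + zmult l x"
      unfolding zmult_diff k l sum_add_const by (simp add: algebra_simps)
    finally show ?thesis .
  qed
  show "zmult 1 x = x"
    by (simp add: zmult_def)
  show "zmult k (zmult l x) = zmult (k * l) x"
  proof -
    have minus: "zmult (- m) y = - zmult m y" for m and y :: 'a
      using add[of m "- m" y] by (simp add: zmult_def)
    have pos: "zmult (int n) (zmult l x) = zmult (int n * l) x" for n
    proof (induction n)
      case 0
      then show ?case by (simp add: zmult_def)
    next
      case (Suc n)
      have "zmult (int (Suc n)) (zmult l x) = zmult (int n) (zmult l x) + zmult l x"
        by (simp add: zmult_of_nat del: of_nat_Suc)
      also have "\<dots> = zmult (int n * l + l) x" by (simp add: Suc add)
      finally show ?case by (simp add: algebra_simps)
    qed
    obtain n where "k = int n \<or> k = - int n" by (metis int_cases2)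
    then show ?thesis using pos[of n] by (auto simp: minus)
  qed
qed

interpretation zmod: module "zmult :: int \<Rightarrow> 'a::ab_group_add \<Rightarrow> 'a"
  by (rule module_zmult)

definition zbasis :: "'a::ab_group_add set \<Rightarrow> bool" where
  "zbasis B \<longleftrightarrow> zmod.independent B \<and> zmod.span B = UNIV"

section \<open>Valued fields\<close>

text \<open>
  The value of \<open>\<nu>\<close> at \<open>0\<close> is irrelevant; \<open>0\<close> is treated as an element of valuation \<open>\<infinity>\<close> throughout.
\<close>

locale nonarch_valuation =
  fixes \<nu> :: "'k::alg_closed_field \<Rightarrow> 'g::linordered_ab_group_add"
  assumes val_mult: "x \<noteq> 0 \<Longrightarrow> y \<noteq> 0 \<Longrightarrow> \<nu> (x * y) = \<nu> x + \<nu> y"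
    and val_add: "x \<noteq> 0 \<Longrightarrow> y \<noteq> 0 \<Longrightarrow> x + y \<noteq> 0 \<Longrightarrow> min (\<nu> x) (\<nu> y) \<le> \<nu> (x + y)"
    and val_surj: "\<exists>x. x \<noteq> 0 \<and> \<nu> x = \<gamma>"
    and val_nontrivial: "\<exists>x. x \<noteq> 0 \<and> \<nu> x \<noteq> 0"
    and val_group_divisible: "0 < n \<Longrightarrow> \<exists>\<delta>. zmult n \<delta> = \<gamma>"

definition val_ring :: "('k::field \<Rightarrow> 'g::linordered_ab_group_add) \<Rightarrow> 'k set" where
  "val_ring \<nu> = {x. x = 0 \<or> 0 \<le> \<nu> x}"

definition val_ideal :: "('k::field \<Rightarrow> 'g::linordered_ab_group_add) \<Rightarrow> 'k set" where
  "val_ideal \<nu> = {x. x = 0 \<or> 0 < \<nu> x}"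

text \<open>
  The residue field \<open>R/\<mm>\<close> is a field type \<open>'r\<close> together with a surjective ring homomorphism
  \<open>red\<close> from \<open>R\<close> with kernel \<open>\<mm>\<close>. The values of \<open>red\<close> outside \<open>R\<close> are irrelevant.
\<close>

locale residue_map =
  fixes \<nu> :: "'k::field \<Rightarrow> 'g::linordered_ab_group_add" and red :: "'k \<Rightarrow> 'r::field"
  assumes red_add: "x \<in> val_ring \<nu> \<Longrightarrow> y \<in> val_ring \<nu> \<Longrightarrow> red (x + y) = red x + red y"
    and red_mult: "x \<in> val_ring \<nu> \<Longrightarrow> y \<in> val_ring \<nu> \<Longrightarrow> red (x * y) = red x * red y"
    and red_one: "red 1 = 1"
    and red_surj: "red ` val_ring \<nu> = UNIV"
    and red_ker: "x \<in> val_ring \<nu> \<Longrightarrow> red x = 0 \<longleftrightarrow> x \<in> val_ideal \<nu>"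

definition valuation_section ::
  "('k::field \<Rightarrow> 'g::linordered_ab_group_add) \<Rightarrow> ('g \<Rightarrow> 'k) \<Rightarrow> bool" where
  "valuation_section \<nu> \<tau> \<longleftrightarrow>
     (\<forall>\<gamma>. \<tau> \<gamma> \<noteq> 0) \<and> (\<forall>\<gamma> \<delta>. \<tau> (\<gamma> + \<delta>) = \<tau> \<gamma> * \<tau> \<delta>) \<and> (\<forall>\<gamma>. \<nu> (\<tau> \<gamma>) = \<gamma>)"

section \<open>Lattices and tori\<close>

text \<open>
  \<open>N\<close> is the type \<open>'n\<close>, \<open>M\<close> is the type \<open>'m\<close>, and the pairing identifies \<open>M\<close> with
  \<open>Hom(N, \<int>)\<close>. The rank may be \<open>0\<close>.
\<close>

locale dual_lattice =
  fixes pair :: "'m::ab_group_add \<Rightarrow> 'n::ab_group_add \<Rightarrow> int"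
  assumes lattice_free: "\<exists>B :: 'n set. finite B \<and> zbasis B"
    and pair_add: "pair (m + m') u = pair m u + pair m' u"
    and pair_hom: "bij_betw pair UNIV {\<phi>. additive \<phi>}"

definition saturated_sublattice :: "'n::ab_group_add set \<Rightarrow> bool" where
  "saturated_sublattice L \<longleftrightarrow>
     zmod.subspace L \<and> (\<forall>k u. k \<noteq> 0 \<longrightarrow> zmult k u \<in> L \<longrightarrow> u \<in> L)"

text \<open>
  \<open>\<Gamma>\<^sub>N = \<Gamma> \<otimes> N\<close> embeds in \<open>Hom(M, \<Gamma>)\<close> by \<open>w \<mapsto> (m \<mapsto> \<langle>m, w\<rangle>)\<close>, so a point of \<open>\<Gamma>\<^sub>N\<close> is the function
  \<open>w :: 'm \<Rightarrow> 'g\<close> with \<open>w m = \<langle>m, w\<rangle>\<close>. For a subgroup \<open>L\<close> of \<open>N\<close>, \<open>\<Gamma>\<^sub>L\<close> consists of the sums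
  \<open>\<Sum>\<^sub>i \<gamma>\<^sub>i \<otimes> u\<^sub>i\<close> with \<open>u\<^sub>i \<in> L\<close>.
\<close>

definition gamma_lattice ::
  "('m \<Rightarrow> 'n \<Rightarrow> int) \<Rightarrow> 'n set \<Rightarrow> ('m \<Rightarrow> 'g::linordered_ab_group_add) set" where
  "gamma_lattice pair L =
     {\<lambda>m. \<Sum>i<k. zmult (pair m (u i)) (\<gamma> i) |(k::nat) u \<gamma>. \<forall>i<k. u i \<in> L}"

abbreviation gammaN :: "('m \<Rightarrow> 'n \<Rightarrow> int) \<Rightarrow> ('m \<Rightarrow> 'g::linordered_ab_group_add) set" where
  "gammaN pair \<equiv> gamma_lattice pair UNIV"

definition torus_points :: "('m::ab_group_add \<Rightarrow> 'f::field) set" where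
  "torus_points = {x. (\<forall>m. x m \<noteq> 0) \<and> (\<forall>m m'. x (m + m') = x m * x m')}"

text \<open>
  \<open>Hom(L, \<int>)\<close> for a subgroup \<open>L\<close> of \<open>N\<close>; homomorphisms are extended by \<open>0\<close> outside \<open>L\<close>.
\<close>

definition dual_of :: "'n::ab_group_add set \<Rightarrow> ('n \<Rightarrow> int) set" where
  "dual_of L = {\<phi>. (\<forall>u\<in>L. \<forall>v\<in>L. \<phi> (u + v) = \<phi> u + \<phi> v) \<and> (\<forall>u. u \<notin> L \<longrightarrow> \<phi> u = 0)}"

text \<open>
  The image of \<open>\<T>\<^sub>L(F) = Hom(Hom(L, \<int>), F\<^sup>*)\<close> in \<open>\<T>\<^sub>N(F) = Hom(M, F\<^sup>*)\<close>, under the map dual to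
  the restriction \<open>M = Hom(N, \<int>) \<rightarrow> Hom(L, \<int>)\<close>.
\<close>

definition subtorus_points ::
  "('m::ab_group_add \<Rightarrow> 'n::ab_group_add \<Rightarrow> int) \<Rightarrow> 'n set \<Rightarrow> ('m \<Rightarrow> 'f::field) set" where
  "subtorus_points pair L =
     {\<lambda>m. y (\<lambda>u. if u \<in> L then pair m u else 0) |y.
        (\<forall>\<phi>\<in>dual_of L. y \<phi> \<noteq> 0) \<and>
        (\<forall>\<phi>\<in>dual_of L. \<forall>\<psi>\<in>dual_of L. y (\<lambda>u. \<phi> u + \<psi> u) = y \<phi> * y \<psi>)}"

section \<open>Ideals, tropicalization and tropical reductions\<close>

text \<open>
  Ideals of a subring \<open>A\<close> of a commutative ring. \<open>K[M]\<close> is the type \<open>'m \<Rightarrow>\<^sub>0 'k\<close>, with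
  \<open>A = UNIV\<close>. A closed subscheme of \<open>\<T>\<^sub>N\<close> is given by its ideal in \<open>K[M]\<close>, and equality of closed
  subschemes is equality of their ideals.
\<close>

definition ideal_in :: "'a::comm_ring_1 set \<Rightarrow> 'a set \<Rightarrow> bool" where
  "ideal_in A J \<longleftrightarrow>
     J \<subseteq> A \<and> 0 \<in> J \<and> (\<forall>p\<in>J. \<forall>q\<in>J. p + q \<in> J) \<and> (\<forall>a\<in>A. \<forall>p\<in>J. a * p \<in> J)"

definition ideal_generated :: "'a::comm_ring_1 set \<Rightarrow> 'a set \<Rightarrow> 'a set" where
  "ideal_generated A S = \<Inter>{J. ideal_in A J \<and> S \<subseteq> J}"

definition laurent_eval :: "('m \<Rightarrow>\<^sub>0 'f::field) \<Rightarrow> ('m \<Rightarrow> 'f) \<Rightarrow> 'f" where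
  "laurent_eval f x = (\<Sum>m\<in>Poly_Mapping.keys f. Poly_Mapping.lookup f m * x m)"

definition tropicalization ::
  "('k::field \<Rightarrow> 'g) \<Rightarrow> ('m::ab_group_add \<Rightarrow>\<^sub>0 'k) set \<Rightarrow> ('m \<Rightarrow> 'g) set" where
  "tropicalization \<nu> I = {\<lambda>m. \<nu> (x m) |x. x \<in> torus_points \<and> (\<forall>f\<in>I. laurent_eval f x = 0)}"

text \<open>
  The formulas for \<open>w(f)\<close> and \<open>f\<^sub>w\<^sub>,\<^sub>\<tau>\<close>, for \<open>f \<noteq> 0\<close>, with an arbitrary type \<open>'a\<close> of monomials and the
  weight \<open>wt m\<close> in place of \<open>\<langle>m, w\<rangle>\<close>, so that they apply to both \<open>K[M]\<close> and
  \<open>K[x\<^sub>0, \<dots>, x\<^sub>n]\<close>.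
\<close>

definition trop_value ::
  "('k::field \<Rightarrow> 'g::linordered_ab_group_add) \<Rightarrow> ('a \<Rightarrow> 'g) \<Rightarrow> ('a \<Rightarrow>\<^sub>0 'k) \<Rightarrow> 'g" where
  "trop_value \<nu> wt f = Min ((\<lambda>m. \<nu> (Poly_Mapping.lookup f m) + wt m) ` Poly_Mapping.keys f)"

definition initial_form ::
  "('k::field \<Rightarrow> 'g::linordered_ab_group_add) \<Rightarrow> ('k \<Rightarrow> 'r::field) \<Rightarrow> ('g \<Rightarrow> 'k) \<Rightarrow>
   ('a \<Rightarrow> 'g) \<Rightarrow> ('a \<Rightarrow>\<^sub>0 'k) \<Rightarrow> ('a \<Rightarrow>\<^sub>0 'r)" where
  "initial_form \<nu> red \<tau> wt f =
     Poly_Mapping.mapp (\<lambda>m c. red (c * \<tau> (wt m - trop_value \<nu> wt f))) f"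

text \<open>The ideal of the tropical reduction \<open>X\<^sub>w\<^sub>,\<^sub>\<tau>\<close>, where \<open>I\<close> is the ideal of \<open>X\<close>.\<close>

definition tropical_reduction ::
  "('k::field \<Rightarrow> 'g::linordered_ab_group_add) \<Rightarrow> ('k \<Rightarrow> 'r::field) \<Rightarrow> ('g \<Rightarrow> 'k) \<Rightarrow>
   ('m::ab_group_add \<Rightarrow> 'g) \<Rightarrow> ('m \<Rightarrow>\<^sub>0 'k) set \<Rightarrow> ('m \<Rightarrow>\<^sub>0 'r) set" where
  "tropical_reduction \<nu> red \<tau> w I =
     ideal_generated UNIV {initial_form \<nu> red \<tau> w f |f. f \<in> I \<and> f \<noteq> 0}"

text \<open>
  If \<open>J\<close> is the ideal of \<open>Y\<close>, then the ideal of the translate \<open>a \<cdot> Y\<close> consists of the \<open>f\<close> whose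
  pullback \<open>f(a \<cdot> \<xi>)\<close> under multiplication by \<open>a\<close>, i.e. under \<open>\<xi>\<^sup>m \<mapsto> a(m) \<xi>\<^sup>m\<close>, lies in \<open>J\<close>.
\<close>

definition translate :: "('m \<Rightarrow> 'f::field) \<Rightarrow> ('m \<Rightarrow>\<^sub>0 'f) set \<Rightarrow> ('m \<Rightarrow>\<^sub>0 'f) set" where
  "translate a J = {f. Poly_Mapping.mapp (\<lambda>m c. c * a m) f \<in> J}"

section \<open>Polyhedral complexes\<close>

definition polyhedron ::
  "('m \<Rightarrow> 'n \<Rightarrow> int) \<Rightarrow> ('m \<Rightarrow> 'g::linordered_ab_group_add) set \<Rightarrow> bool" where
  "polyhedron pair \<sigma> \<longleftrightarrow>
     (\<exists>H. finite H \<and> \<sigma> = {w \<in> gammaN pair. \<forall>(m, a)\<in>H. w m \<ge> a})"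

definition face_of_polyhedron ::
  "('m \<Rightarrow> 'g::linordered_ab_group_add) set \<Rightarrow> ('m \<Rightarrow> 'g) set \<Rightarrow> bool" where
  "face_of_polyhedron F \<sigma> \<longleftrightarrow>
     F = \<sigma> \<or> F \<noteq> {} \<and> (\<exists>m a. (\<forall>w\<in>\<sigma>. w m \<ge> a) \<and> F = {w \<in> \<sigma>. w m = a})"

definition relint :: "('m \<Rightarrow> 'g::linordered_ab_group_add) set \<Rightarrow> ('m \<Rightarrow> 'g) set" where
  "relint \<sigma> = \<sigma> - \<Union>{F. face_of_polyhedron F \<sigma> \<and> F \<noteq> \<sigma>}"

text \<open>
  \<open>\<langle>\<sigma>\<rangle>\<close>: the saturated sublattice for which \<open>\<Gamma>\<^sub>\<langle>\<^sub>\<sigma>\<^sub>\<rangle>\<close> is the intersection of the subgroups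
  \<open>{v. \<langle>m, v\<rangle> = 0}\<close> containing all differences of elements of \<open>\<sigma>\<close>.
\<close>

definition linear_lattice ::
  "('m \<Rightarrow> 'n::ab_group_add \<Rightarrow> int) \<Rightarrow> ('m \<Rightarrow> 'g::linordered_ab_group_add) set \<Rightarrow> 'n set" where
  "linear_lattice pair \<sigma> =
     (THE L. saturated_sublattice L \<and>
        gamma_lattice pair L =
          \<Inter>{V. \<exists>m. V = {v \<in> gammaN pair. v m = 0} \<and> (\<forall>w\<in>\<sigma>. \<forall>w'\<in>\<sigma>. (\<lambda>i. w i - w' i) \<in> V)})"

text \<open>The members of a complex are required to be nonempty.\<close>

definition polyhedral_complex ::
  "('m \<Rightarrow> 'n \<Rightarrow> int) \<Rightarrow> ('m \<Rightarrow> 'g::linordered_ab_group_add) set set \<Rightarrow> bool" where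
  "polyhedral_complex pair \<C> \<longleftrightarrow>
     finite \<C> \<and>
     (\<forall>\<sigma>\<in>\<C>. polyhedron pair \<sigma> \<and> \<sigma> \<noteq> {}) \<and>
     (\<forall>\<sigma>\<in>\<C>. \<forall>F. face_of_polyhedron F \<sigma> \<longrightarrow> F \<in> \<C>) \<and>
     (\<forall>\<sigma>\<in>\<C>. \<forall>\<rho>\<in>\<C>. \<sigma> \<inter> \<rho> = {} \<or>
        face_of_polyhedron (\<sigma> \<inter> \<rho>) \<sigma> \<and> face_of_polyhedron (\<sigma> \<inter> \<rho>) \<rho>)"

definition minimal_faces :: "('m \<Rightarrow> 'g) set set \<Rightarrow> ('m \<Rightarrow> 'g) set set" where
  "minimal_faces \<C> = {\<sigma> \<in> \<C>. \<forall>\<rho>\<in>\<C>. \<rho> \<subseteq> \<sigma> \<longrightarrow> \<rho> = \<sigma>}"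

section \<open>The complex induced by a projective compactification\<close>

text \<open>
  Monomials in \<open>x\<^sub>0, x\<^sub>1, \<dots>\<close> are exponent vectors \<open>\<mu> :: nat \<Rightarrow>\<^sub>0 nat\<close>. A projective compactification is
  given by a basis \<open>e 1, \<dots>, e n\<close> of \<open>M\<close>, where \<open>x\<^sub>i\<close> is the monomial of \<open>e i\<close> for \<open>1 \<le> i \<le> n\<close> and
  \<open>x\<^sub>0\<close> is the homogenizing variable.
\<close>

definition polys_in :: "nat set \<Rightarrow> ((nat \<Rightarrow>\<^sub>0 nat) \<Rightarrow>\<^sub>0 'f::zero) set" where
  "polys_in V = {p. \<forall>\<mu>\<in>Poly_Mapping.keys p. Poly_Mapping.keys \<mu> \<subseteq> V}"

definition total_deg :: "(nat \<Rightarrow>\<^sub>0 nat) \<Rightarrow> nat" where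
  "total_deg \<mu> = (\<Sum>i\<in>Poly_Mapping.keys \<mu>. Poly_Mapping.lookup \<mu> i)"

text \<open>The inclusion of \<open>K[x\<^sub>1, \<dots>, x\<^sub>n]\<close> in \<open>K[M]\<close>.\<close>

definition poly_to_laurent ::
  "(nat \<Rightarrow> 'm::ab_group_add) \<Rightarrow> ((nat \<Rightarrow>\<^sub>0 nat) \<Rightarrow>\<^sub>0 'k::field) \<Rightarrow> ('m \<Rightarrow>\<^sub>0 'k)" where
  "poly_to_laurent e p =
     (\<Sum>\<mu>\<in>Poly_Mapping.keys p.
        Poly_Mapping.single
          (\<Sum>i\<in>Poly_Mapping.keys \<mu>. zmult (int (Poly_Mapping.lookup \<mu> i)) (e i))
          (Poly_Mapping.lookup p \<mu>))"

definition homogenize ::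
  "((nat \<Rightarrow>\<^sub>0 nat) \<Rightarrow>\<^sub>0 'k::field) \<Rightarrow> ((nat \<Rightarrow>\<^sub>0 nat) \<Rightarrow>\<^sub>0 'k)" where
  "homogenize p =
     (\<Sum>\<mu>\<in>Poly_Mapping.keys p.
        Poly_Mapping.single
          (\<mu> + Poly_Mapping.single 0 (Max (total_deg ` Poly_Mapping.keys p) - total_deg \<mu>))
          (Poly_Mapping.lookup p \<mu>))"

definition homogenized_ideal ::
  "nat \<Rightarrow> (nat \<Rightarrow> 'm::ab_group_add) \<Rightarrow> ('m \<Rightarrow>\<^sub>0 'k::field) set \<Rightarrow> ((nat \<Rightarrow>\<^sub>0 nat) \<Rightarrow>\<^sub>0 'k) set" where
  "homogenized_ideal n e I =
     ideal_generated (polys_in {0..n})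
       (homogenize ` {p \<in> polys_in {1..n}. poly_to_laurent e p \<in> I})"

definition poly_weight ::
  "nat \<Rightarrow> (nat \<Rightarrow> 'm) \<Rightarrow> ('m \<Rightarrow> 'g::linordered_ab_group_add) \<Rightarrow> (nat \<Rightarrow>\<^sub>0 nat) \<Rightarrow> 'g" where
  "poly_weight n e w \<mu> = (\<Sum>i = 1..n. zmult (int (Poly_Mapping.lookup \<mu> i)) (w (e i)))"

definition initial_ideal ::
  "('k::field \<Rightarrow> 'g::linordered_ab_group_add) \<Rightarrow> ('k \<Rightarrow> 'r::field) \<Rightarrow> ('g \<Rightarrow> 'k) \<Rightarrow>
   nat \<Rightarrow> (nat \<Rightarrow> 'm::ab_group_add) \<Rightarrow> ('m \<Rightarrow> 'g) \<Rightarrow> ((nat \<Rightarrow>\<^sub>0 nat) \<Rightarrow>\<^sub>0 'k) set \<Rightarrow>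
   ((nat \<Rightarrow>\<^sub>0 nat) \<Rightarrow>\<^sub>0 'r) set" where
  "initial_ideal \<nu> red \<tau> n e w J =
     ideal_generated (polys_in {0..n})
       {initial_form \<nu> red \<tau> (poly_weight n e w) f |f. f \<in> J \<and> f \<noteq> 0}"

text \<open>
  The case \<open>w = u\<close> of the last condition says that every point of \<open>\<Gamma>\<^sub>N\<close> lies in the relative interior of
  some face.
\<close>

definition groebner_complex ::
  "('m::ab_group_add \<Rightarrow> 'n \<Rightarrow> int) \<Rightarrow> ('k::field \<Rightarrow> 'g::linordered_ab_group_add) \<Rightarrow>
   ('k \<Rightarrow> 'r::field) \<Rightarrow> ('g \<Rightarrow> 'k) \<Rightarrow> nat \<Rightarrow> (nat \<Rightarrow> 'm) \<Rightarrow> ((nat \<Rightarrow>\<^sub>0 nat) \<Rightarrow>\<^sub>0 'k) set \<Rightarrow>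
   ('m \<Rightarrow> 'g) set set \<Rightarrow> bool" where
  "groebner_complex pair \<nu> red \<tau> n e J \<G> \<longleftrightarrow>
     polyhedral_complex pair \<G> \<and>
     (\<forall>w\<in>gammaN pair. \<forall>u\<in>gammaN pair.
        (\<exists>\<sigma>\<in>\<G>. w \<in> relint \<sigma> \<and> u \<in> relint \<sigma>) \<longleftrightarrow>
        initial_ideal \<nu> red \<tau> n e w J = initial_ideal \<nu> red \<tau> n e u J)"

text \<open>
  The initial ideals depend on a section \<open>s\<close> of the valuation, which may be any section.
\<close>

definition projectively_induced_complex ::
  "('m::ab_group_add \<Rightarrow> 'n \<Rightarrow> int) \<Rightarrow> ('k::field \<Rightarrow> 'g::linordered_ab_group_add) \<Rightarrow>
   ('k \<Rightarrow> 'r::field) \<Rightarrow> ('m \<Rightarrow>\<^sub>0 'k) set \<Rightarrow> ('m \<Rightarrow> 'g) set set \<Rightarrow> bool" where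
  "projectively_induced_complex pair \<nu> red I \<C> \<longleftrightarrow>
     (\<exists>n e s \<G>.
        inj_on e {1..n} \<and> zbasis (e ` {1..n}) \<and>
        valuation_section \<nu> s \<and>
        groebner_complex pair \<nu> red s n e (homogenized_ideal n e I) \<G> \<and>
        \<C> = {\<sigma> \<in> \<G>. \<sigma> \<subseteq> tropicalization \<nu> I})"

end

theory Submission
  imports Defs
begin

text \<open>
  Let \<open>\<beta> : \<Gamma> \<rightarrow> \<k>\<^sup>*\<close> be the homomorphism obtained by reducing \<open>t / \<tau>\<close>. For \<open>w \<in> \<Gamma>\<^sub>N\<close> let \<open>a\<^sub>w\<close> be the torus point
  \<open>m \<mapsto> \<beta> \<langle>m, w\<rangle>\<close>; the \<open>a\<^sub>\<sigma>\<close> of the theorem is the value of this at the chosen point \<open>w\<^sub>\<sigma>\<close>. Changing the section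
  multiplies the coefficients of all initial forms at \<open>w\<close> by the values of \<open>a\<^sub>w\<close>, up to a common constant, so
  \<open>X\<^sub>w\<^sub>,\<^sub>\<tau> = a\<^sub>w \<cdot> X\<^sub>w\<^sub>,\<^sub>t\<close> (\<open>reductions_change_section\<close>). It remains to replace \<open>a\<^sub>w\<close> by \<open>a\<^sub>\<sigma>\<close>. If \<open>\<phi>\<close> is the face with
  \<open>w\<close> in its relative interior, then \<open>w - w\<^sub>\<sigma> \<in> \<Gamma>\<^sub>\<langle>\<^sub>\<phi>\<^sub>\<rangle>\<close>, so \<open>w - w\<^sub>\<sigma> = \<Sum> \<gamma>\<^sub>i \<otimes> u\<^sub>i\<close> with \<open>u\<^sub>i \<in> \<langle>\<phi>\<rangle>\<close>, and
  \<open>a\<^sub>w / a\<^sub>\<sigma>\<close> is the product of the values of the one-parameter subgroups \<open>u\<^sub>i\<close> at \<open>\<beta> \<gamma>\<^sub>i\<close>. The same computation, for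
  two minimal faces of \<open>\<rho>\<close>, gives the statement on cosets of \<open>\<T>\<^sub>\<langle>\<^sub>\<rho>\<^sub>\<rangle>\<close>.

  So the point is that the subtorus \<open>\<T>\<^sub>\<langle>\<^sub>\<phi>\<^sub>\<rangle>\<close> leaves \<open>X\<^sub>w\<^sub>,\<^sub>t\<close> invariant (\<open>reductions_graded\<close>). For \<open>u \<in> \<langle>\<phi>\<rangle>\<close> and small
  \<open>\<delta> > 0\<close> in \<open>\<Gamma>\<close> the point \<open>w + \<delta> \<otimes> u\<close> stays in the relative interior of \<open>\<phi>\<close> (\<open>relint_perturbation\<close>), and so
  the initial ideal of the homogenized ideal is the same there as at \<open>w\<close>. But for \<open>\<delta>\<close> small enough,
  depending on \<open>f\<close>, the initial form of \<open>f\<close> at \<open>w + \<delta> \<otimes> u\<close> is the part of lowest \<open>u\<close>-degree of the initial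
  form at \<open>w\<close>. Hence the initial ideal is graded by \<open>u\<close> (\<open>reductions_scale_invariant\<close>), and dehomogenization
  carries this to \<open>K[M]\<close> (\<open>reductions_from_homogenized\<close>, \<open>dehomogenize_reductions\<close>). Moving along the segment
  from \<open>w\<close> towards \<open>w\<^sub>\<sigma>\<close> would not do: in a non-archimedean \<open>\<Gamma>\<close> its rational points may all be far from \<open>w\<close>.
  This is why the direction is an integral vector \<open>u\<close> and the length \<open>\<delta>\<close> an arbitrarily small element of \<open>\<Gamma>\<close>.

  Two reformulations keep this elementary. The initial forms of an ideal are, up to \<open>0\<close>, the
  coefficientwise reductions of those of its elements that become integral after twisting by the section
  (\<open>ideal_generated_initial_forms\<close>), which makes initial ideals compatible with monomial substitutions.
  And the integral vectors annihilated by all \<open>m\<close> that are constant on \<open>\<phi>\<close> form the lattice \<open>\<langle>\<phi>\<rangle>\<close>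
  (\<open>linear_lattice_eq\<close>), because finitely many elements of \<open>\<Gamma>\<close> are integral combinations of integrally
  independent ones (\<open>finite_subset_span_independent\<close>).
\<close>

section \<open>Substituting and rescaling monomials\<close>

abbreviation lookup :: "('a \<Rightarrow>\<^sub>0 'b::zero) \<Rightarrow> 'a \<Rightarrow> 'b" where "lookup \<equiv> Poly_Mapping.lookup"
abbreviation keys :: "('a \<Rightarrow>\<^sub>0 'b::zero) \<Rightarrow> 'a set" where "keys \<equiv> Poly_Mapping.keys"
abbreviation single :: "'a \<Rightarrow> 'b::zero \<Rightarrow> 'a \<Rightarrow>\<^sub>0 'b" where "single \<equiv> Poly_Mapping.single"

text \<open>
  For a torus point \<open>\<chi>\<close> this is the pullback along multiplication by \<open>\<chi>\<close>, written as in \<open>translate\<close>; for \<open>\<chi>\<close>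
  with values \<open>0\<close> and \<open>1\<close> it selects some of the terms.
\<close>

abbreviation scale :: "('a \<Rightarrow> 'f::field) \<Rightarrow> ('a \<Rightarrow>\<^sub>0 'f) \<Rightarrow> ('a \<Rightarrow>\<^sub>0 'f)" where
  "scale \<chi> \<equiv> Poly_Mapping.mapp (\<lambda>m c. c * \<chi> m)"

text \<open>
  \<open>push h\<close> substitutes monomials, sending \<open>x\<^sup>m\<close> to \<open>x\<^bsup>h m\<^esup>\<close>. Dehomogenization and the inclusion of
  \<open>K[x\<^sub>1, \<dots>, x\<^sub>n]\<close> in \<open>K[M]\<close> have this form with an additive \<open>h\<close>; homogenization has it with an \<open>h\<close>
  that depends on the polynomial.
\<close>

definition push :: "('a \<Rightarrow> 'b) \<Rightarrow> ('a \<Rightarrow>\<^sub>0 'f::comm_monoid_add) \<Rightarrow> ('b \<Rightarrow>\<^sub>0 'f)" where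
  "push h f = (\<Sum>m\<in>keys f. single (h m) (lookup f m))"

text \<open>
  Exponent vectors only form a monoid, to which the locale \<open>additive\<close> for groups does not apply.
\<close>

definition additive_map :: "('a::plus \<Rightarrow> 'b::plus) \<Rightarrow> bool" where
  "additive_map h \<longleftrightarrow> (\<forall>i j. h (i + j) = h i + h j)"

lemma additive_mapD: "additive_map h \<Longrightarrow> h (i + j) = h i + h j"
  by (simp add: additive_map_def)

lemma lookup_scale [simp]: "lookup (scale \<chi> f) m = lookup f m * \<chi> m"
  by (auto simp: lookup_mapp when_def in_keys_iff)

lemma scale_zero: "scale \<chi> 0 = 0"
  by (rule poly_mapping_eqI) simp

lemma scale_scale: "scale \<chi> (scale \<psi> f) = scale (\<lambda>m. \<chi> m * \<psi> m) f"
  by (rule poly_mapping_eqI) (simp add: mult_ac)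

lemma scale_single: "scale \<chi> (single m c) = single m (c * \<chi> m)"
  by (rule poly_mapping_eqI) (simp add: lookup_single when_def)

lemma scale_sum: "scale \<chi> (sum F A) = (\<Sum>i\<in>A. scale \<chi> (F i))"
  by (rule poly_mapping_eqI) (simp add: lookup_sum sum_distrib_right)

lemma push_superset:
  assumes "finite S" "keys f \<subseteq> S"
  shows "push h f = (\<Sum>m\<in>S. single (h m) (lookup f m))"
  unfolding push_def using assms by (intro sum.mono_neutral_left) (auto simp: in_keys_iff)

lemma push_id: "push (\<lambda>m. m) f = f"
  by (rule poly_mapping_eqI)
     (simp add: push_def lookup_sum lookup_single when_def in_keys_iff)

lemma push_zero [simp]: "push h 0 = 0"
  by (simp add: push_def)

lemma push_add: "push h (f + g) = push h f + push h g"
  using keys_add[of f g]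
  by (simp add: push_superset[of "keys f \<union> keys g"] lookup_add single_add sum.distrib)

lemma push_single: "push h (single m c) = single (h m) c"
  by (cases "c = 0") (simp_all add: push_def)

lemma push_sum: "push h (sum F A) = (\<Sum>i\<in>A. push h (F i))"
  by (induction A rule: infinite_finite_induct) (simp_all add: push_add)

lemma push_push: "push h (push k f) = push (\<lambda>m. h (k m)) f"
  by (simp add: push_def[of k] push_sum push_single) (simp add: push_def)

lemma push_cong: "(\<And>m. m \<in> keys f \<Longrightarrow> h m = k m) \<Longrightarrow> push h f = push k f"
  by (simp add: push_def)

lemma keys_push: "keys (push h f) \<subseteq> h ` keys f"
  unfolding push_def using keys_sum[of "\<lambda>m. single (h m) (lookup f m)" "keys f"]
  by (auto split: if_splits)

lemma mult_as_sum:
  fixes f g :: "'a::comm_monoid_add \<Rightarrow>\<^sub>0 'f::comm_ring_1"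
  shows "f * g = (\<Sum>i\<in>keys f. \<Sum>j\<in>keys g. single (i + j) (lookup f i * lookup g j))"
proof -
  have "f * g = push (\<lambda>m. m) f * push (\<lambda>m. m) g"
    by (simp add: push_id)
  then show ?thesis
    by (simp add: push_def sum_product mult_single)
qed

lemma constant_mult: "single 0 c * f = scale (\<lambda>_. c) f"
  for f :: "'a::comm_monoid_add \<Rightarrow>\<^sub>0 'f::field"
proof -
  have "single 0 c * push (\<lambda>m. m) f = scale (\<lambda>_. c) (push (\<lambda>m. m) f)"
    by (simp add: push_def sum_distrib_left mult_single scale_sum scale_single mult_ac)
  then show ?thesis
    by (simp add: push_id)
qed

lemma push_mult:
  fixes f g :: "'a::comm_monoid_add \<Rightarrow>\<^sub>0 'f::comm_ring_1"
  assumes "additive_map h"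
  shows "push h (f * g) = push h f * push h g"
  by (simp add: mult_as_sum[of f g] push_sum push_single additive_mapD[OF assms])
     (simp add: push_def sum_product mult_single)

lemma scale_mult:
  fixes f g :: "'a::comm_monoid_add \<Rightarrow>\<^sub>0 'f::field"
  assumes "\<And>i j. \<chi> (i + j) = \<chi> i * \<chi> j"
  shows "scale \<chi> (f * g) = scale \<chi> f * scale \<chi> g"
proof -
  have *: "scale \<chi> f = (\<Sum>i\<in>keys f. single i (lookup f i * \<chi> i))" for f
    by (subst (1) push_id[of f, symmetric]) (simp add: push_def scale_sum scale_single)
  show ?thesis
    by (simp add: mult_as_sum[of f g] scale_sum scale_single *[of f] *[of g] assms
        sum_product mult_single mult_ac)
qed

lemma scale_push:
  assumes "\<And>m. m \<in> keys f \<Longrightarrow> \<psi> (h m) = \<chi> m"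
  shows "scale \<psi> (push h f) = push h (scale \<chi> f)"
proof -
  have "keys (scale \<chi> f) \<subseteq> keys f"
    by (rule keys_mapp_subset)
  then show ?thesis
    by (simp add: push_superset[of "keys f"] scale_sum scale_single assms)
qed

section \<open>Ideals of rings spanned by monomials\<close>

text \<open>
  For a submonoid \<open>P\<close> of the monomials this is a subring; it is \<open>K[M]\<close> or \<open>K[x\<^sub>0, \<dots>, x\<^sub>n]\<close>, according
  to \<open>P\<close>, and so both kinds of initial ideals can be treated at once.
\<close>

definition supported :: "'a set \<Rightarrow> ('a \<Rightarrow>\<^sub>0 'f::zero) set" where
  "supported P = {f. keys f \<subseteq> P}"

lemma polys_in_eq_supported: "polys_in V = supported {\<mu>. keys \<mu> \<subseteq> V}"
  by (auto simp: polys_in_def supported_def)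

lemma UNIV_eq_supported: "UNIV = supported UNIV"
  by (simp add: supported_def)

lemma ideal_in_supported:
  fixes P :: "'a::comm_monoid_add set"
  assumes "\<And>i j. i \<in> P \<Longrightarrow> j \<in> P \<Longrightarrow> i + j \<in> P"
  shows "ideal_in (supported P) (supported P :: ('a \<Rightarrow>\<^sub>0 'f::comm_ring_1) set)"
proof -
  have "p + q \<in> supported P" if "p \<in> supported P" "q \<in> supported P" for p q :: "'a \<Rightarrow>\<^sub>0 'f"
    using that keys_add[of p q] by (auto simp: supported_def)
  moreover have "p * q \<in> supported P" if "p \<in> supported P" "q \<in> supported P" for p q :: "'a \<Rightarrow>\<^sub>0 'f"
  proof -
    have "{a + b |a b. a \<in> keys p \<and> b \<in> keys q} \<subseteq> P"
      using that assms unfolding supported_def by blast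
    then show ?thesis
      using keys_mult[of p q] unfolding supported_def by blast
  qed
  ultimately show ?thesis
    by (auto simp: ideal_in_def supported_def)
qed

lemma ideal_inD:
  assumes "ideal_in A J"
  shows "J \<subseteq> A" "0 \<in> J" "p \<in> J \<Longrightarrow> q \<in> J \<Longrightarrow> p + q \<in> J" "a \<in> A \<Longrightarrow> p \<in> J \<Longrightarrow> a * p \<in> J"
  using assms by (simp_all add: ideal_in_def)

lemma ideal_in_generated:
  assumes "ideal_in A A" "S \<subseteq> A"
  shows "ideal_in A (ideal_generated A S)"
  unfolding ideal_in_def
proof (intro conjI ballI)
  have mem: "x \<in> ideal_generated A S \<longleftrightarrow> (\<forall>J. ideal_in A J \<longrightarrow> S \<subseteq> J \<longrightarrow> x \<in> J)" for x
    by (auto simp: ideal_generated_def)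
  show "ideal_generated A S \<subseteq> A"
    using assms by (auto simp: mem)
  show "0 \<in> ideal_generated A S"
    by (simp add: mem ideal_in_def)
  show "p + q \<in> ideal_generated A S"
    if "p \<in> ideal_generated A S" "q \<in> ideal_generated A S" for p q
    using that by (simp add: mem ideal_in_def)
  show "a * p \<in> ideal_generated A S" if "a \<in> A" "p \<in> ideal_generated A S" for a p
    using that by (simp add: mem ideal_in_def)
qed

lemma generators_subset_ideal_generated: "S \<subseteq> ideal_generated A S"
  by (auto simp: ideal_generated_def)

lemma ideal_generated_least: "ideal_in A J \<Longrightarrow> S \<subseteq> J \<Longrightarrow> ideal_generated A S \<subseteq> J"
  by (auto simp: ideal_generated_def)

section \<open>Initial ideals as ideals of reductions\<close>

locale valued_residue = nonarch_valuation \<nu> + residue_map \<nu> red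
  for \<nu> :: "'k::alg_closed_field \<Rightarrow> 'g::linordered_ab_group_add"
    and red :: "'k \<Rightarrow> 'r::field"
begin

lemma val_one: "\<nu> 1 = 0"
  using val_mult[of 1 1] by simp

lemma zero_in_val_ring [simp]: "0 \<in> val_ring \<nu>" by (simp add: val_ring_def)

lemma one_in_val_ring [simp]: "1 \<in> val_ring \<nu>" by (simp add: val_ring_def val_one)

lemma val_ring_add: "x \<in> val_ring \<nu> \<Longrightarrow> y \<in> val_ring \<nu> \<Longrightarrow> x + y \<in> val_ring \<nu>"
  using val_add[of x y] unfolding val_ring_def mem_Collect_eq
  by (metis add.right_neutral add.left_neutral min_def order.trans)

lemma val_ring_mult: "x \<in> val_ring \<nu> \<Longrightarrow> y \<in> val_ring \<nu> \<Longrightarrow> x * y \<in> val_ring \<nu>"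
  by (cases "x = 0 \<or> y = 0") (auto simp: val_ring_def val_mult)

lemma red_zero [simp]: "red 0 = 0"
  using red_ker[of 0] by (simp add: val_ideal_def)

lemma red_eq_zero: "x \<in> val_ring \<nu> \<Longrightarrow> red x = 0 \<longleftrightarrow> x = 0 \<or> 0 < \<nu> x"
  using red_ker[of x] by (simp add: val_ideal_def)

lemma section_nonzero [simp]: "valuation_section \<nu> s \<Longrightarrow> s \<gamma> \<noteq> 0"
  and section_add: "valuation_section \<nu> s \<Longrightarrow> s (\<gamma> + \<delta>) = s \<gamma> * s \<delta>"
  and val_section: "valuation_section \<nu> s \<Longrightarrow> \<nu> (s \<gamma>) = \<gamma>"
  by (auto simp: valuation_section_def)

lemma section_zero: "valuation_section \<nu> s \<Longrightarrow> s 0 = 1"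
  using section_add[of s 0 0] section_nonzero[of s 0] by simp

lemma section_minus: "valuation_section \<nu> s \<Longrightarrow> s (- \<gamma>) = inverse (s \<gamma>)"
  using section_add[of s \<gamma> "- \<gamma>"] section_zero[of s]
  by (metis add.right_inverse inverse_unique)

lemma mult_section_in_val_ring:
  "valuation_section \<nu> s \<Longrightarrow> c * s \<gamma> \<in> val_ring \<nu> \<longleftrightarrow> c = 0 \<or> 0 \<le> \<nu> c + \<gamma>"
  by (cases "c = 0") (simp_all add: val_ring_def val_mult val_section)

lemma red_mult_section_eq_zero:
  "valuation_section \<nu> s \<Longrightarrow> c * s \<gamma> \<in> val_ring \<nu> \<Longrightarrow>
    red (c * s \<gamma>) = 0 \<longleftrightarrow> c = 0 \<or> 0 < \<nu> c + \<gamma>"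
  by (cases "c = 0") (simp_all add: red_eq_zero val_mult val_section)

text \<open>
  \<open>reduces s wt f g\<close>: after the substitution \<open>x\<^sup>m \<mapsto> s (wt m) x\<^sup>m\<close> the polynomial \<open>f\<close> has coefficients in the
  valuation ring, and \<open>g\<close> is its reduction. If \<open>wt(f) = 0\<close> then \<open>g\<close> is the initial form of \<open>f\<close>, and if
  \<open>wt(f) > 0\<close> then \<open>g = 0\<close>. Unlike taking initial forms, this relation is compatible with sums.
\<close>

definition reduces ::
  "('g \<Rightarrow> 'k) \<Rightarrow> ('a \<Rightarrow> 'g) \<Rightarrow> ('a \<Rightarrow>\<^sub>0 'k) \<Rightarrow> ('a \<Rightarrow>\<^sub>0 'r) \<Rightarrow> bool" where
  "reduces s wt f g \<longleftrightarrow>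
     (\<forall>m. lookup f m * s (wt m) \<in> val_ring \<nu> \<and> lookup g m = red (lookup f m * s (wt m)))"

lemma reduces_zero: "reduces s wt 0 0"
  by (simp add: reduces_def)

lemma reduces_add: "reduces s wt f g \<Longrightarrow> reduces s wt f' g' \<Longrightarrow> reduces s wt (f + f') (g + g')"
  by (simp add: reduces_def lookup_add distrib_right val_ring_add red_add)

lemma reduces_sum:
  "(\<And>i. i \<in> A \<Longrightarrow> reduces s wt (F i) (H i)) \<Longrightarrow> reduces s wt (sum F A) (sum H A)"
  by (induction A rule: infinite_finite_induct) (simp_all add: reduces_zero reduces_add)

lemma reduces_single:
  "c * s (wt m) \<in> val_ring \<nu> \<Longrightarrow> r = red (c * s (wt m)) \<Longrightarrow>
    reduces s wt (single m c) (single m r)"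
  by (simp add: reduces_def lookup_single when_def)

lemma keys_reduces: "reduces s wt f g \<Longrightarrow> keys g \<subseteq> keys f"
  by (auto simp: reduces_def in_keys_iff)

text \<open>
  Several monomials may be identified by \<open>h\<close>: as they have the same weight, their coefficients are
  twisted by the same factor, and reduction commutes with adding them up.
\<close>

lemma reduces_push:
  assumes "reduces s wt f g" "\<And>m. m \<in> keys f \<Longrightarrow> wt' (h m) = wt m"
  shows "reduces s wt' (push h f) (push h g)"
proof -
  note push_superset[OF finite_keys keys_reduces[OF assms(1)], of h]
  moreover have "reduces s wt' (single (h m) (lookup f m)) (single (h m) (lookup g m))"
    if "m \<in> keys f" for m
    using assms that by (intro reduces_single) (auto simp: reduces_def)
  ultimately show ?thesis
    by (auto simp: push_def[of h f] intro: reduces_sum)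
qed

lemma reduces_mult:
  fixes f f' :: "'a::comm_monoid_add \<Rightarrow>\<^sub>0 'k"
  assumes s: "valuation_section \<nu> s" and wt: "additive_map wt"
    and r: "reduces s wt f g" and r': "reduces s wt f' g'"
  shows "reduces s wt (f * f') (g * g')"
proof -
  have "f * f' = (\<Sum>i\<in>keys f. \<Sum>j\<in>keys f'. single (i + j) (lookup f i * lookup f' j))"
    by (rule mult_as_sum)
  moreover have "g * g' = (\<Sum>i\<in>keys f. \<Sum>j\<in>keys f'. single (i + j) (lookup g i * lookup g' j))"
  proof -
    have "g = push (\<lambda>m. m) g" "g' = push (\<lambda>m. m) g'"
      by (simp_all add: push_id)
    then have "g = (\<Sum>i\<in>keys f. single i (lookup g i))"
        "g' = (\<Sum>j\<in>keys f'. single j (lookup g' j))"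
      using push_superset[OF finite_keys keys_reduces[OF r], of "\<lambda>m. m"]
        push_superset[OF finite_keys keys_reduces[OF r'], of "\<lambda>m. m"] by simp_all
    then have "g * g' = (\<Sum>i\<in>keys f. single i (lookup g i)) * (\<Sum>j\<in>keys f'. single j (lookup g' j))"
      by (rule arg_cong2)
    then show ?thesis
      by (simp add: sum_product mult_single)
  qed
  moreover have "reduces s wt (single (i + j) (lookup f i * lookup f' j))
                   (single (i + j) (lookup g i * lookup g' j))" for i j
  proof -
    have "lookup f i * lookup f' j * s (wt (i + j)) =
        (lookup f i * s (wt i)) * (lookup f' j * s (wt j))"
      by (simp add: additive_mapD[OF wt] section_add[OF s])
    moreover have "lookup f i * s (wt i) \<in> val_ring \<nu>" "lookup f' j * s (wt j) \<in> val_ring \<nu>"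
        "lookup g i = red (lookup f i * s (wt i))" "lookup g' j = red (lookup f' j * s (wt j))"
      using r r' by (simp_all add: reduces_def)
    ultimately show ?thesis
      by (intro reduces_single) (simp_all only: val_ring_mult red_mult)
  qed
  ultimately show ?thesis
    by (simp add: reduces_sum)
qed

lemma reduces_lift:
  assumes s: "valuation_section \<nu> s"
  shows "\<exists>f. keys f \<subseteq> keys g \<and> reduces s wt f g"
proof -
  have "\<exists>c. c * s (wt m) \<in> val_ring \<nu> \<and> red (c * s (wt m)) = r" for m and r :: 'r
  proof -
    obtain x where x: "x \<in> val_ring \<nu>" "red x = r"
      using red_surj by (metis UNIV_I imageE)
    have "x / s (wt m) * s (wt m) = x"
      using s by simp
    then show ?thesis using x by metis
  qed
  then obtain c where c: "c m r * s (wt m) \<in> val_ring \<nu>" "red (c m r * s (wt m)) = r" for m r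
    by metis
  let ?f = "\<Sum>m\<in>keys g. single m (c m (lookup g m))"
  have "reduces s wt ?f (push (\<lambda>m. m) g)"
    unfolding push_def by (intro reduces_sum reduces_single) (auto simp: c)
  moreover have "keys ?f \<subseteq> keys g"
    using keys_sum[of "\<lambda>m. single m (c m (lookup g m))" "keys g"] by (auto split: if_splits)
  ultimately show ?thesis
    by (auto simp: push_id)
qed

definition reductions ::
  "('g \<Rightarrow> 'k) \<Rightarrow> ('a \<Rightarrow> 'g) \<Rightarrow> ('a \<Rightarrow>\<^sub>0 'k) set \<Rightarrow> ('a \<Rightarrow>\<^sub>0 'r) set" where
  "reductions s wt J = {g. \<exists>f\<in>J. reduces s wt f g}"

text \<open>
  Reductions of elements of \<open>J\<close> add, and they may be multiplied by any polynomial over the residue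
  field, because such a polynomial lifts.
\<close>

lemma ideal_in_reductions:
  fixes J :: "('a::comm_monoid_add \<Rightarrow>\<^sub>0 'k) set"
  assumes s: "valuation_section \<nu> s" and wt: "additive_map wt"
    and J: "ideal_in (supported P) J"
  shows "ideal_in (supported P) (reductions s wt J)"
  unfolding ideal_in_def
proof (intro conjI ballI)
  show "reductions s wt J \<subseteq> supported P"
    using J keys_reduces by (fastforce simp: reductions_def ideal_in_def supported_def)
  show "0 \<in> reductions s wt J"
    using J reduces_zero by (auto simp: reductions_def ideal_in_def)
next
  fix g g' assume "g \<in> reductions s wt J" "g' \<in> reductions s wt J"
  then show "g + g' \<in> reductions s wt J"
    using J unfolding reductions_def ideal_in_def by (blast intro: reduces_add)
next
  fix a g :: "'a \<Rightarrow>\<^sub>0 'r"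
  assume a: "a \<in> supported P" and g: "g \<in> reductions s wt J"
  obtain b where b: "keys b \<subseteq> keys a" "reduces s wt b a"
    using reduces_lift[OF s, of a wt] by auto
  obtain f where f: "f \<in> J" "reduces s wt f g"
    using g by (auto simp: reductions_def)
  have "reduces s wt (b * f) (a * g)"
    by (rule reduces_mult[OF s wt b(2) f(2)])
  moreover have "b \<in> supported P"
    using a b(1) by (auto simp: supported_def)
  then have "b * f \<in> J"
    by (rule ideal_inD(4)[OF J _ f(1)])
  ultimately show "a * g \<in> reductions s wt J"
    unfolding reductions_def by blast
qed

lemma initial_form_eq_if_reduces:
  assumes s: "valuation_section \<nu> s" and r: "reduces s wt f g" and "g \<noteq> 0"
  shows "f \<noteq> 0" "initial_form \<nu> red s wt f = g"
proof -
  obtain m where m: "lookup g m \<noteq> 0"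
    using \<open>g \<noteq> 0\<close> by (metis lookup_zero poly_mapping_eqI)
  have integral: "lookup f i * s (wt i) \<in> val_ring \<nu>"
    and red: "lookup g i = red (lookup f i * s (wt i))" for i
    using r by (auto simp: reduces_def)
  have "m \<in> keys f"
    using m red[of m] by (auto simp: in_keys_iff)
  then show "f \<noteq> 0" by auto
  have nonneg: "0 \<le> \<nu> (lookup f i) + wt i" if "i \<in> keys f" for i
    using that integral[of i] s by (auto simp: mult_section_in_val_ring in_keys_iff)
  have "\<nu> (lookup f m) + wt m = 0"
    using m integral[of m] red[of m] nonneg[OF \<open>m \<in> keys f\<close>] s
    by (auto simp: red_mult_section_eq_zero)
  then have "trop_value \<nu> wt f = 0"
    unfolding trop_value_def using nonneg \<open>m \<in> keys f\<close>
    by (intro Min_eqI) force+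
  then show "initial_form \<nu> red s wt f = g"
    by (intro poly_mapping_eqI)
       (auto simp: initial_form_def lookup_mapp when_def red in_keys_iff)
qed

text \<open>
  Dividing \<open>f\<close> by an element of valuation \<open>wt(f)\<close> makes its weight \<open>0\<close> and keeps its initial form.
\<close>

lemma initial_form_in_reductions:
  assumes s: "valuation_section \<nu> s" and J: "ideal_in (supported P) J" and "0 \<in> P"
    and f: "f \<in> J" "f \<noteq> 0"
  shows "initial_form \<nu> red s wt f \<in> reductions s wt J"
proof -
  let ?v = "trop_value \<nu> wt f"
  let ?f = "single 0 (s (- ?v)) * f"
  have "?f \<in> J"
    using J f \<open>0 \<in> P\<close> by (auto simp: ideal_in_def supported_def)
  moreover have "?f = scale (\<lambda>m. s (- ?v)) f"
    by (rule constant_mult)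
  moreover have "reduces s wt (scale (\<lambda>m. s (- ?v)) f) (initial_form \<nu> red s wt f)"
    unfolding reduces_def
  proof (intro allI conjI)
    fix m
    have *: "lookup (scale (\<lambda>m. s (- ?v)) f) m * s (wt m) = lookup f m * s (wt m - ?v)"
      using section_add[OF s, of "- ?v" "wt m"] by simp
    have "?v \<le> \<nu> (lookup f m) + wt m" if "m \<in> keys f"
      unfolding trop_value_def using that by (intro Min_le) auto
    then have "lookup f m * s (wt m - ?v) \<in> val_ring \<nu>"
      using s by (cases "m \<in> keys f") (auto simp: mult_section_in_val_ring in_keys_iff algebra_simps)
    then show "lookup (scale (\<lambda>m. s (- ?v)) f) m * s (wt m) \<in> val_ring \<nu>"
      by (simp only: *)
    show "lookup (initial_form \<nu> red s wt f) m = red (lookup (scale (\<lambda>m. s (- ?v)) f) m * s (wt m))"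
      unfolding * by (simp add: initial_form_def lookup_mapp when_def in_keys_iff)
  qed
  ultimately show ?thesis
    by (auto simp: reductions_def)
qed

text \<open>
  The initial forms already make up, together with \<open>0\<close>, the ideal that they generate. This description
  by reductions replaces the generated ideal everywhere below.
\<close>

lemma ideal_generated_initial_forms:
  fixes J :: "('a::comm_monoid_add \<Rightarrow>\<^sub>0 'k) set"
  assumes s: "valuation_section \<nu> s" and wt: "additive_map wt"
    and J: "ideal_in (supported P) J" and P: "0 \<in> P"
  shows "ideal_generated (supported P) {initial_form \<nu> red s wt f |f. f \<in> J \<and> f \<noteq> 0} =
    reductions s wt J"
proof (rule equalityI)
  have "{initial_form \<nu> red s wt f |f. f \<in> J \<and> f \<noteq> 0} \<subseteq> reductions s wt J"
    using initial_form_in_reductions[OF s J P] by auto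
  then show "ideal_generated (supported P) {initial_form \<nu> red s wt f |f. f \<in> J \<and> f \<noteq> 0} \<subseteq>
      reductions s wt J"
    by (rule ideal_generated_least[OF ideal_in_reductions[OF s wt J]])
next
  show "reductions s wt J \<subseteq>
      ideal_generated (supported P) {initial_form \<nu> red s wt f |f. f \<in> J \<and> f \<noteq> 0}"
  proof
    fix g assume "g \<in> reductions s wt J"
    then obtain f where f: "f \<in> J" "reduces s wt f g"
      by (auto simp: reductions_def)
    show "g \<in> ideal_generated (supported P) {initial_form \<nu> red s wt f |f. f \<in> J \<and> f \<noteq> 0}"
    proof (cases "g = 0")
      case True
      then show ?thesis by (auto simp: ideal_generated_def ideal_in_def)
    next
      case False
      then have "g \<in> {initial_form \<nu> red s wt f |f. f \<in> J \<and> f \<noteq> 0}"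
        using f initial_form_eq_if_reduces[OF s f(2)] by auto
      then show ?thesis
        by (rule subsetD[OF generators_subset_ideal_generated])
    qed
  qed
qed

end

section \<open>Integer multiples in ordered groups\<close>

lemma zmult_nonneg: "0 \<le> k \<Longrightarrow> 0 \<le> x \<Longrightarrow> 0 \<le> zmult k (x :: 'a::linordered_ab_group_add)"
  by (simp add: zmult_def sum_nonneg)

lemma zmult_mono: "j \<le> k \<Longrightarrow> 0 \<le> x \<Longrightarrow> zmult j x \<le> zmult k (x :: 'a::linordered_ab_group_add)"
  using zmult_nonneg[of "k - j" x] by (simp add: zmod.scale_left_diff_distrib)

lemma zmult_mono_right: "0 \<le> k \<Longrightarrow> x \<le> y \<Longrightarrow> zmult k x \<le> zmult k (y :: 'a::linordered_ab_group_add)"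
  using zmult_nonneg[of k "y - x"] by (simp add: zmod.scale_right_diff_distrib)

lemma zmult_pos: "0 < k \<Longrightarrow> 0 < x \<Longrightarrow> 0 < zmult k (x :: 'a::linordered_ab_group_add)"
  using zmult_mono[of 1 k x] by (simp add: order.strict_trans2[of 0 x])

lemma zmult_eq_zero_iff:
  "zmult k x = 0 \<longleftrightarrow> k = 0 \<or> (x :: 'a::linordered_ab_group_add) = 0"
proof -
  have pos: "zmult k x \<noteq> 0" if "k \<noteq> 0" "0 < x" for k and x :: 'a
    using that zmult_pos[of k x] zmult_pos[of "- k" x] by (cases "0 < k") auto
  show ?thesis
    using pos[of k x] pos[of k "- x"] by (cases "k = 0"; cases x "0 :: 'a" rule: linorder_cases) auto
qed

lemma hom_zmult:
  fixes \<beta> :: "'a::ab_group_add \<Rightarrow> 'f::field"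
  assumes add: "\<And>x y. \<beta> (x + y) = \<beta> x * \<beta> y" and nz: "\<And>x. \<beta> x \<noteq> 0"
  shows "\<beta> (zmult k x) = \<beta> x powi k"
proof -
  have zero: "\<beta> 0 = 1"
    using add[of 0 0] nz[of 0] by simp
  have minus: "\<beta> (- x) = inverse (\<beta> x)" for x
    using add[of x "- x"] zero by (simp add: inverse_unique)
  have nat: "\<beta> (zmult (int n) x) = \<beta> x ^ n" for n
    unfolding zmult_of_nat by (induction n) (simp_all add: zero add mult.commute)
  obtain n where "k = int n \<or> k = - int n"
    by (metis int_cases2)
  then show ?thesis
    using nat[of n] by (auto simp: minus power_int_minus)
qed

lemma hom_sum:
  fixes \<beta> :: "'a::ab_group_add \<Rightarrow> 'f::field"
  assumes add: "\<And>x y. \<beta> (x + y) = \<beta> x * \<beta> y" and nz: "\<And>x. \<beta> x \<noteq> 0"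
  shows "\<beta> (\<Sum>i\<in>A. f i) = (\<Prod>i\<in>A. \<beta> (f i))"
proof -
  have zero: "\<beta> 0 = 1"
    using add[of 0 0] nz[of 0] by simp
  then show ?thesis
    by (induction A rule: infinite_finite_induct) (simp_all add: add)
qed

context nonarch_valuation
begin

lemma exists_pos: "\<exists>\<gamma>::'g. 0 < \<gamma>"
  using val_nontrivial by (metis neg_0_less_iff_less neqE)

text \<open>
  The value group need not embed in the reals, so an element of it cannot in general be made small by
  multiplying with a rational number. Instead one divides the smallest element of \<open>E\<close> by a large integer,
  which gives an element that is small compared to all of \<open>E\<close>.
\<close>

lemma small_multiples:
  fixes E :: "'g set"
  assumes E: "finite E" "\<And>e. e \<in> E \<Longrightarrow> 0 < e" and Z: "finite Z"
  shows "\<exists>\<delta>>0. \<forall>\<delta>'. 0 < \<delta>' \<and> \<delta>' \<le> \<delta> \<longrightarrow> (\<forall>j\<in>Z. \<forall>e\<in>E. 0 < e + zmult j \<delta>')"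
proof -
  obtain e0 :: 'g where e0: "0 < e0"
    using exists_pos by blast
  define e where "e = Min (insert e0 E)"
  have e: "0 < e" "\<And>x. x \<in> E \<Longrightarrow> e \<le> x"
    using E e0 by (auto simp: e_def)
  \<comment> \<open>An upper bound for the absolute values of the multipliers, \<open>0\<close> if there are none.\<close>
  define k where "k = Max (insert 0 (abs ` Z))"
  have k: "0 \<le> k" "\<And>j. j \<in> Z \<Longrightarrow> - j \<le> k"
  proof -
    show "0 \<le> k"
      using Z by (simp add: k_def)
    show "- j \<le> k" if "j \<in> Z" for j
    proof -
      have "\<bar>j\<bar> \<le> k"
        using Z that by (simp add: k_def)
      then show ?thesis by simp
    qed
  qed
  obtain \<delta> where \<delta>: "zmult (k + 1) \<delta> = e"
    using val_group_divisible[of "k + 1" e] k by auto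
  have "0 < \<delta>"
  proof (rule ccontr)
    assume "\<not> 0 < \<delta>"
    then have "0 \<le> zmult (k + 1) (- \<delta>)"
      using k by (intro zmult_nonneg) auto
    then show False using \<delta> e by simp
  qed
  moreover have "0 < x + zmult j \<delta>'" if "0 < \<delta>'" "\<delta>' \<le> \<delta>" "j \<in> Z" "x \<in> E" for \<delta>' j x
  proof -
    have "zmult (- j) \<delta>' \<le> zmult k \<delta>'"
      using k that by (intro zmult_mono) auto
    also have "\<dots> \<le> zmult k \<delta>"
      using k that by (intro zmult_mono_right) auto
    also have "\<dots> < e"
      using \<delta> \<open>0 < \<delta>\<close> by (auto simp: zmod.scale_left_distrib)
    also have "\<dots> \<le> x"
      using e that by auto
    finally have "- zmult j \<delta>' < x" by simp
    then show ?thesis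
      using add_strict_right_mono[of "- zmult j \<delta>'" x "zmult j \<delta>'"] by simp
  qed
  ultimately show ?thesis by blast
qed

end

section \<open>Initial ideals that are locally constant in a lattice direction\<close>

context valued_residue
begin

text \<open>
  If the initial ideal gains nothing when \<open>wt\<close> moves a little in the integral direction \<open>u\<close>, then it is
  homogeneous for the grading by \<open>u\<close>, hence invariant under the one-parameter group \<open>x\<^sup>m \<mapsto> c\<^bsup>u m\<^esup> x\<^sup>m\<close>.
  Indeed, if \<open>f\<close> reduces to \<open>g\<close> at \<open>wt\<close>, then after a small move a multiple of \<open>f\<close> reduces to the part of
  \<open>g\<close> of lowest degree. This part therefore lies in the same ideal; it is split off, and the argument is
  repeated with what remains of \<open>g\<close>.
\<close>

lemma reductions_scale_invariant:
  fixes J :: "('a::comm_monoid_add \<Rightarrow>\<^sub>0 'k) set" and u :: "'a \<Rightarrow> int"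
  assumes s: "valuation_section \<nu> s" and wt: "additive_map wt"
    and J: "ideal_in (supported P) J" and P: "0 \<in> P"
    and \<epsilon>: "0 < \<epsilon>"
    and const: "\<And>\<delta>. 0 < \<delta> \<Longrightarrow> \<delta> \<le> \<epsilon> \<Longrightarrow>
      reductions s (\<lambda>m. wt m + zmult (u m) \<delta>) J \<subseteq> reductions s wt J"
    and g: "g \<in> reductions s wt J"
  shows "scale (\<lambda>m. c powi u m) g \<in> reductions s wt J"
  using g
proof (induction "card (keys g)" arbitrary: g rule: less_induct)
  case less
  note G = ideal_in_reductions[OF s wt J]
  have const_in_P: "single 0 x \<in> supported P" for x :: "'x::zero"
    using P by (simp add: supported_def)
  show ?case
  proof (cases "g = 0")
    case True
    then show ?thesis
      using less.prems by (simp add: scale_zero)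
  next
    case False
    obtain f where f: "f \<in> J" "reduces s wt f g"
      using less.prems by (auto simp: reductions_def)
    have integral: "lookup f m * s (wt m) \<in> val_ring \<nu>"
      and red: "lookup g m = red (lookup f m * s (wt m))" for m
      using f by (auto simp: reduces_def)
    define d where "d = Min (u ` keys g)"
    define low where "low = scale (\<lambda>m. if u m = d then 1 else 0) g"
    define rest where "rest = scale (\<lambda>m. if u m = d then 0 else 1) g"
    have d: "d \<in> u ` keys g" "\<And>m. m \<in> keys g \<Longrightarrow> d \<le> u m"
      using False by (auto simp: d_def)
    \<comment> \<open>The weights of the terms of \<open>f\<close> that vanish in the reduction; the move must keep them positive.\<close>
    let ?E = "(\<lambda>m. \<nu> (lookup f m) + wt m) ` (keys f - keys g)"
    have "0 < \<nu> (lookup f m) + wt m" if "lookup f m \<noteq> 0" "lookup g m = 0" for m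
      using that red[of m] red_mult_section_eq_zero[OF s integral[of m]] by simp
    then have E: "0 < e" if "e \<in> ?E" for e
      using that by (auto simp: in_keys_iff)
    have "\<exists>\<delta>>0. \<forall>\<delta>'. 0 < \<delta>' \<and> \<delta>' \<le> \<delta> \<longrightarrow>
        (\<forall>j\<in>(\<lambda>m. u m - d) ` keys f. \<forall>e\<in>?E. 0 < e + zmult j \<delta>')"
      using E by (intro small_multiples) auto
    then obtain \<delta>0 where \<delta>0: "0 < \<delta>0" "\<And>\<delta> m e. 0 < \<delta> \<Longrightarrow> \<delta> \<le> \<delta>0 \<Longrightarrow> m \<in> keys f \<Longrightarrow> e \<in> ?E \<Longrightarrow>
        0 < e + zmult (u m - d) \<delta>"
      by blast
    define \<delta> where "\<delta> = min \<delta>0 \<epsilon>"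
    have \<delta>: "0 < \<delta>" "\<delta> \<le> \<delta>0" "\<delta> \<le> \<epsilon>"
      using \<delta>0 \<epsilon> by (auto simp: \<delta>_def)
    \<comment> \<open>The factor compensates the change \<open>d\<cdot>\<delta>\<close> in the weight of the terms of lowest degree.\<close>
    have "reduces s (\<lambda>m. wt m + zmult (u m) \<delta>) (single 0 (s (- zmult d \<delta>)) * f) low"
      unfolding reduces_def
    proof
      fix m
      have *: "lookup (single 0 (s (- zmult d \<delta>)) * f) m * s (wt m + zmult (u m) \<delta>) =
          lookup f m * s (wt m + zmult (u m - d) \<delta>)"
      proof -
        have "wt m + zmult (u m - d) \<delta> = - zmult d \<delta> + (wt m + zmult (u m) \<delta>)"
          by (simp add: zmod.scale_left_diff_distrib)
        then show ?thesis
          unfolding constant_mult by (simp only: section_add[OF s] lookup_scale mult_ac)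
      qed
      consider "m \<notin> keys f" | "m \<in> keys g" "u m = d" | "m \<in> keys g" "d < u m" | "m \<in> keys f" "m \<notin> keys g"
        using d(2) by force
      then show "lookup (single 0 (s (- zmult d \<delta>)) * f) m * s (wt m + zmult (u m) \<delta>) \<in> val_ring \<nu> \<and>
          lookup low m = red (lookup (single 0 (s (- zmult d \<delta>)) * f) m * s (wt m + zmult (u m) \<delta>))"
        unfolding *
      proof cases
        case 1
        then show "lookup f m * s (wt m + zmult (u m - d) \<delta>) \<in> val_ring \<nu> \<and>
            lookup low m = red (lookup f m * s (wt m + zmult (u m - d) \<delta>))"
          using red[of m] by (simp add: in_keys_iff low_def)
      next
        case 2
        then show "lookup f m * s (wt m + zmult (u m - d) \<delta>) \<in> val_ring \<nu> \<and>
            lookup low m = red (lookup f m * s (wt m + zmult (u m - d) \<delta>))"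
          using red[of m] integral[of m] by (simp add: low_def)
      next
        case 3
        then have "0 < zmult (u m - d) \<delta>"
          using \<delta> by (intro zmult_pos) auto
        then have pos: "0 < zmult (u m - d) \<delta>" "s (zmult (u m - d) \<delta>) \<in> val_ring \<nu>"
          using s by (auto simp: val_ring_def val_section)
        have eq: "lookup f m * s (wt m + zmult (u m - d) \<delta>) = lookup f m * s (wt m) * s (zmult (u m - d) \<delta>)"
          by (simp add: section_add[OF s])
        have rz: "red (s (zmult (u m - d) \<delta>)) = 0"
          using pos s by (simp add: red_eq_zero val_section)
        show "lookup f m * s (wt m + zmult (u m - d) \<delta>) \<in> val_ring \<nu> \<and>
            lookup low m = red (lookup f m * s (wt m + zmult (u m - d) \<delta>))"
          unfolding eq using pos integral[of m] 3 rz by (simp add: low_def red_mult val_ring_mult)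
      next
        case 4
        then have pos: "0 < \<nu> (lookup f m) + wt m + zmult (u m - d) \<delta>"
          using \<delta> by (intro \<delta>0) auto
        then have "lookup f m * s (wt m + zmult (u m - d) \<delta>) \<in> val_ring \<nu>"
          using less_imp_le[OF pos] by (simp add: mult_section_in_val_ring[OF s] add.assoc)
        moreover from this have "red (lookup f m * s (wt m + zmult (u m - d) \<delta>)) = 0"
          using s pos by (simp add: red_mult_section_eq_zero add.assoc)
        ultimately show "lookup f m * s (wt m + zmult (u m - d) \<delta>) \<in> val_ring \<nu> \<and>
            lookup low m = red (lookup f m * s (wt m + zmult (u m - d) \<delta>))"
          using 4 by (simp add: low_def in_keys_iff)
      qed
    qed
    moreover have "single 0 (s (- zmult d \<delta>)) * f \<in> J"
      using f const_in_P by (intro ideal_inD(4)[OF J])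
    ultimately have low: "low \<in> reductions s wt J"
      using const[OF \<delta>(1,3)] by (auto simp: reductions_def)
    have "rest = g + single 0 (- 1) * low"
      by (rule poly_mapping_eqI)
         (simp only: constant_mult lookup_add lookup_scale rest_def low_def, simp)
    then have "rest \<in> reductions s wt J"
      by (simp only:) (intro ideal_inD(3,4)[OF G] const_in_P low less.prems)
    moreover have "card (keys rest) < card (keys g)"
    proof (rule psubset_card_mono)
      obtain m0 where "m0 \<in> keys g" "u m0 = d"
        using d(1) by auto
      moreover have "m0 \<notin> keys rest" if "u m0 = d" for m0
        using that by (simp add: rest_def in_keys_iff)
      moreover have "keys rest \<subseteq> keys g"
        unfolding rest_def by (rule keys_mapp_subset)
      ultimately show "keys rest \<subset> keys g"
        by auto
    qed simp
    ultimately have "scale (\<lambda>m. c powi u m) rest \<in> reductions s wt J"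
      by (rule less.hyps[rotated])
    moreover have "single 0 (c powi d) * low \<in> reductions s wt J"
      using low const_in_P by (intro ideal_inD(4)[OF G])
    moreover have "scale (\<lambda>m. c powi u m) g = single 0 (c powi d) * low + scale (\<lambda>m. c powi u m) rest"
      by (rule poly_mapping_eqI)
         (simp only: constant_mult lookup_add lookup_scale rest_def low_def, simp)
    ultimately show ?thesis
      using ideal_inD(3)[OF G] by simp
  qed
qed

section \<open>Change of the section\<close>

definition residue_ratio :: "('g \<Rightarrow> 'k) \<Rightarrow> ('g \<Rightarrow> 'k) \<Rightarrow> 'g \<Rightarrow> 'r" where
  "residue_ratio s' s \<gamma> = red (s' \<gamma> / s \<gamma>)"

lemma ratio_in_val_ring:
  "valuation_section \<nu> s \<Longrightarrow> valuation_section \<nu> s' \<Longrightarrow> s' \<gamma> / s \<gamma> \<in> val_ring \<nu>"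
  using mult_section_in_val_ring[of s "s' \<gamma>" "- \<gamma>"]
  by (simp add: section_minus val_section divide_inverse)

lemma residue_ratio_add:
  "valuation_section \<nu> s \<Longrightarrow> valuation_section \<nu> s' \<Longrightarrow>
    residue_ratio s' s (\<gamma> + \<delta>) = residue_ratio s' s \<gamma> * residue_ratio s' s \<delta>"
  unfolding residue_ratio_def
  by (subst red_mult[symmetric]) (simp_all add: ratio_in_val_ring section_add)

lemma residue_ratio_swap:
  "valuation_section \<nu> s \<Longrightarrow> valuation_section \<nu> s' \<Longrightarrow>
    residue_ratio s' s \<gamma> * residue_ratio s s' \<gamma> = 1"
  unfolding residue_ratio_def
  by (subst red_mult[symmetric]) (simp_all add: ratio_in_val_ring red_one)

lemma residue_ratio_nonzero:
  "valuation_section \<nu> s \<Longrightarrow> valuation_section \<nu> s' \<Longrightarrow> residue_ratio s' s \<gamma> \<noteq> 0"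
  using residue_ratio_swap[of s s' \<gamma>] by auto

text \<open>
  Passing from \<open>s\<close> to \<open>s'\<close> multiplies the twisted coefficient of \<open>x\<^sup>m\<close> by the unit \<open>s'(wt m) / s(wt m)\<close>
  of the valuation ring, for every element of \<open>J\<close> alike.
\<close>

lemma reductions_change_section:
  assumes s: "valuation_section \<nu> s" and s': "valuation_section \<nu> s'"
  shows "scale (\<lambda>m. residue_ratio s' s (wt m)) g \<in> reductions s' wt J \<longleftrightarrow> g \<in> reductions s wt J"
proof -
  have *: "scale (\<lambda>m. residue_ratio s' s (wt m)) g \<in> reductions s' wt J"
    if s: "valuation_section \<nu> s" and s': "valuation_section \<nu> s'" and g: "g \<in> reductions s wt J" for s s' g
  proof -
    obtain f where f: "f \<in> J" "reduces s wt f g"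
      using g by (auto simp: reductions_def)
    have "reduces s' wt f (scale (\<lambda>m. residue_ratio s' s (wt m)) g)"
      unfolding reduces_def
    proof
      fix m
      have "lookup f m * s' (wt m) = lookup f m * s (wt m) * (s' (wt m) / s (wt m))"
        using s by simp
      moreover have "lookup f m * s (wt m) \<in> val_ring \<nu>" "lookup g m = red (lookup f m * s (wt m))"
        using f by (auto simp: reduces_def)
      ultimately show "lookup f m * s' (wt m) \<in> val_ring \<nu> \<and>
          lookup (scale (\<lambda>m. residue_ratio s' s (wt m)) g) m = red (lookup f m * s' (wt m))"
        using ratio_in_val_ring[OF s s']
        by (simp only: val_ring_mult red_mult lookup_scale residue_ratio_def simp_thms)
    qed
    then show ?thesis
      using f by (auto simp: reductions_def)
  qed
  have "scale (\<lambda>m. residue_ratio s s' (wt m)) (scale (\<lambda>m. residue_ratio s' s (wt m)) g) = g"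
    by (rule poly_mapping_eqI) (simp add: mult.assoc residue_ratio_swap[OF s s'])
  then show ?thesis
    using *[OF s s'] *[OF s' s] by metis
qed

end

section \<open>Lattices and tensors with the value group\<close>

lemma additive_zmult:
  assumes "additive h"
  shows "h (zmult k x) = zmult k (h x)"
  using assms by (simp add: zmult_def additive.minus additive.sum)

lemma zmult_int: "zmult k (j :: int) = k * j"
  by (simp add: zmult_def)

context nonarch_valuation
begin

text \<open>
  A finitely generated subgroup of the value group, being torsion-free, lies in a free one of finite
  rank. When a new generator \<open>\<gamma>\<close> is dependent on the basis found so far, say \<open>d\<gamma> = \<Sum> e\<^sub>b b\<close>, divisibility allows
  to replace the basis elements \<open>b\<close> by \<open>b/d\<close>, and \<open>\<gamma>\<close> falls into the new span.
\<close>

lemma finite_subset_span_independent: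
  fixes S :: "'g set"
  assumes "finite S"
  shows "\<exists>B. finite B \<and> zmod.independent B \<and> S \<subseteq> zmod.span B"
  using assms
proof (induction S rule: finite_induct)
  case empty
  then show ?case by (intro exI[of _ "{}"]) (simp add: zmod.independent_empty)
next
  case (insert \<gamma> S)
  then obtain B where B: "finite B" "zmod.independent B" "S \<subseteq> zmod.span B"
    by blast
  consider "\<gamma> \<in> B" | "zmod.independent (insert \<gamma> B)" | "\<gamma> \<notin> B" "zmod.dependent (insert \<gamma> B)"
    by blast
  then show ?case
  proof cases
    case 1
    then show ?thesis
      using B by (blast intro: zmod.span_base)
  next
    case 2
    then show ?thesis
      using B zmod.span_mono[of B "insert \<gamma> B"]
      by (intro exI[of _ "insert \<gamma> B"]) (auto intro: zmod.span_base)
  next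
    case 3
    obtain c where c: "\<exists>b\<in>insert \<gamma> B. c b \<noteq> 0" "(\<Sum>b\<in>insert \<gamma> B. zmult (c b) b) = 0"
      using 3 B by (auto simp only: zmod.dependent_finite finite_insert)
    have sum0: "zmult (c \<gamma>) \<gamma> = - (\<Sum>b\<in>B. zmult (c b) b)"
      using c(2) 3 B by (simp add: add_eq_0_iff2)
    have nz: "c \<gamma> \<noteq> 0"
    proof
      assume "c \<gamma> = 0"
      then have "(\<Sum>b\<in>B. zmult (c b) b) = 0" "\<exists>b\<in>B. c b \<noteq> 0"
        using sum0 c by auto
      then show False
        using B by (auto simp: zmod.dependent_finite)
    qed
    define d where "d = \<bar>c \<gamma>\<bar>"
    have d: "0 < d" using nz by (simp add: d_def)
    have "\<exists>e. zmult d \<gamma> = (\<Sum>b\<in>B. zmult (e b) b)"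
    proof (cases "0 < c \<gamma>")
      case True
      then show ?thesis
        using sum0 by (intro exI[of _ "\<lambda>b. - c b"]) (simp add: d_def sum_negf)
    next
      case False
      then show ?thesis
        using sum0 by (intro exI[of _ c]) (simp add: d_def)
    qed
    then obtain e where e: "zmult d \<gamma> = (\<Sum>b\<in>B. zmult (e b) b)" by blast
    obtain h :: "'g \<Rightarrow> 'g" where h: "zmult d (h b) = b" for b
      using val_group_divisible[OF d] by metis
    have inj: "inj_on h B"
      by (metis h inj_onI)
    have "zmod.independent (h ` B)"
    proof
      assume "zmod.dependent (h ` B)"
      then obtain f where f: "\<exists>b\<in>B. f (h b) \<noteq> 0" "(\<Sum>b\<in>B. zmult (f (h b)) (h b)) = 0"
        using B inj by (auto simp: zmod.dependent_finite sum.reindex)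
      have "(\<Sum>b\<in>B. zmult (f (h b)) b) = (\<Sum>b\<in>B. zmult (f (h b)) (zmult d (h b)))"
        by (simp only: h)
      also have "\<dots> = zmult d (\<Sum>b\<in>B. zmult (f (h b)) (h b))"
        by (simp add: zmod.scale_sum_right mult.commute)
      finally have "(\<Sum>b\<in>B. zmult (f (h b)) b) = 0"
        using f by simp
      then show False
        using B f(1) zmod.independentD[of B B "\<lambda>b. f (h b)"] by auto
    qed
    moreover have "B \<subseteq> zmod.span (h ` B)"
      by (metis h imageI subsetI zmod.span_base zmod.span_scale)
    then have "S \<subseteq> zmod.span (h ` B)"
      using B zmod.span_minimal by blast
    moreover have "\<gamma> = (\<Sum>b\<in>B. zmult (e b) (h b))"
    proof -
      have "zmult d \<gamma> = (\<Sum>b\<in>B. zmult (e b) (zmult d (h b)))"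
        using e by (simp only: h)
      also have "\<dots> = zmult d (\<Sum>b\<in>B. zmult (e b) (h b))"
        by (simp add: zmod.scale_sum_right mult.commute)
      finally have "zmult d (\<gamma> - (\<Sum>b\<in>B. zmult (e b) (h b))) = 0"
        by (simp add: zmod.scale_right_diff_distrib)
      then show ?thesis
        using d by (simp add: zmult_eq_zero_iff)
    qed
    then have "\<gamma> \<in> zmod.span (h ` B)"
      by (metis (no_types, lifting) imageI zmod.span_base zmod.span_scale zmod.span_sum)
    ultimately show ?thesis
      using B by (intro exI[of _ "h ` B"]) auto
  qed
qed

end

context dual_lattice
begin

lemma additive_pair: "additive (pair m)"
  using pair_hom by (auto simp: bij_betw_def)

lemma pair_zmult: "pair m (zmult k u) = k * pair m u"
  by (simp add: additive_zmult[OF additive_pair] zmult_int)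

lemmas pair_sum = additive.sum[OF additive_pair]
  and pair_diff = additive.diff[OF additive_pair]
  and pair_zero = additive.zero[OF additive_pair]
  and pair_plus = additive.add[OF additive_pair]

text \<open>
  Each coordinate function of a basis of \<open>N\<close> is additive, hence is given by an element of \<open>M\<close>.
\<close>

lemma pair_nondegenerate:
  assumes "\<And>m. pair m u = 0"
  shows "u = 0"
proof -
  obtain B :: "'n set" where B: "finite B" "zmod.independent B" "zmod.span B = UNIV"
    using lattice_free by (auto simp: zbasis_def)
  have "zmod.representation B u b = 0" for b
  proof -
    have "additive (\<lambda>v. zmod.representation B v b)"
      using B by unfold_locales (simp add: zmod.representation_add)
    then have "(\<lambda>v. zmod.representation B v b) \<in> range pair"
      using pair_hom by (auto simp: bij_betw_def)
    then obtain m where "(\<lambda>v. zmod.representation B v b) = pair m"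
      by blast
    then show ?thesis
      using assms[of m] by metis
  qed
  then show ?thesis
    using zmod.sum_representation_eq[of B u B] B by simp
qed

lemma gamma_lattice_sumI:
  assumes "finite S" "\<And>b. b \<in> S \<Longrightarrow> u b \<in> L"
  shows "(\<lambda>m. \<Sum>b\<in>S. zmult (pair m (u b)) (g b)) \<in> gamma_lattice pair L"
proof -
  obtain h where h: "bij_betw h {0..<card S} S"
    using ex_bij_betw_nat_finite[OF assms(1)] by blast
  have "(\<Sum>b\<in>S. zmult (pair m (u b)) (g b)) = (\<Sum>i<card S. zmult (pair m (u (h i))) (g (h i)))" for m
    using sum.reindex_bij_betw[OF h, of "\<lambda>b. zmult (pair m (u b)) (g b)"]
    by (simp add: lessThan_atLeast0)
  then have "(\<lambda>m. \<Sum>b\<in>S. zmult (pair m (u b)) (g b)) =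
      (\<lambda>m. \<Sum>i<card S. zmult (pair m (u (h i))) (g (h i)))"
    by simp
  moreover have "\<forall>i<card S. u (h i) \<in> L"
    using assms(2) bij_betwE[OF h] by simp
  ultimately show ?thesis
    unfolding gamma_lattice_def mem_Collect_eq by (intro exI conjI)
qed

lemma gamma_latticeE:
  assumes "v \<in> gamma_lattice pair L"
  obtains k :: nat and u \<gamma> where "v = (\<lambda>m. \<Sum>i<k. zmult (pair m (u i)) (\<gamma> i))" "\<And>i. i < k \<Longrightarrow> u i \<in> L"
  using assms unfolding gamma_lattice_def by blast

lemma gamma_lattice_additive:
  assumes "v \<in> gamma_lattice pair L"
  shows "v (m + m') = v m + v m'"
  using assms by (elim gamma_latticeE) (simp add: pair_add zmod.scale_left_distrib sum.distrib)

lemma gamma_lattice_add: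
  assumes "v \<in> gamma_lattice pair L" "v' \<in> gamma_lattice pair L"
  shows "(\<lambda>m. v m + v' m) \<in> gamma_lattice pair L"
proof -
  obtain k :: nat and u \<gamma> where v: "v = (\<lambda>m. \<Sum>i<k. zmult (pair m (u i)) (\<gamma> i))" "\<And>i. i < k \<Longrightarrow> u i \<in> L"
    using assms(1) by (rule gamma_latticeE) blast
  obtain k' :: nat and u' \<gamma>' where v': "v' = (\<lambda>m. \<Sum>i<k'. zmult (pair m (u' i)) (\<gamma>' i))" "\<And>i. i < k' \<Longrightarrow> u' i \<in> L"
    using assms(2) by (rule gamma_latticeE) blast
  have "(\<lambda>m. \<Sum>i\<in>{..<k} <+> {..<k'}. zmult (pair m (case_sum u u' i)) (case_sum \<gamma> \<gamma>' i))
      \<in> gamma_lattice pair L"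
    using v v' by (intro gamma_lattice_sumI) auto
  then show ?thesis
    by (simp add: v v' sum.Plus)
qed

lemma gamma_lattice_diff:
  assumes "v \<in> gamma_lattice pair L" "v' \<in> gamma_lattice pair L"
  shows "(\<lambda>m. v m - v' m) \<in> gamma_lattice pair L"
proof -
  obtain k :: nat and u \<gamma> where v': "v' = (\<lambda>m. \<Sum>i<k. zmult (pair m (u i)) (\<gamma> i))" "\<And>i. i < k \<Longrightarrow> u i \<in> L"
    using assms(2) by (rule gamma_latticeE) blast
  have "(\<lambda>m. \<Sum>i<k. zmult (pair m (u i)) (- \<gamma> i)) \<in> gamma_lattice pair L"
    using v' by (intro gamma_lattice_sumI) auto
  from gamma_lattice_add[OF assms(1) this] show ?thesis
    by (simp add: v' sum_negf)
qed

lemma gamma_lattice_tensor: "u \<in> L \<Longrightarrow> (\<lambda>m. zmult (pair m u) \<gamma>) \<in> gamma_lattice pair L"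
  using gamma_lattice_sumI[of "{()}" "\<lambda>_. u" L "\<lambda>_. \<gamma>"] by simp

end

locale valued_lattice = nonarch_valuation \<nu> + dual_lattice pair
  for \<nu> :: "'k::alg_closed_field \<Rightarrow> 'g::linordered_ab_group_add"
    and pair :: "'m::ab_group_add \<Rightarrow> 'n::ab_group_add \<Rightarrow> int"
begin

lemma saturated_annihilator: "saturated_sublattice {u. \<forall>m\<in>P. pair m u = 0}"
  unfolding saturated_sublattice_def zmod.subspace_def
  by (auto simp: pair_zero pair_plus pair_zmult)

text \<open>
  Write \<open>v = \<Sum> b \<otimes> u\<^sub>b\<close> with integrally independent \<open>b\<close>. Then \<open>0 = v m = \<Sum> \<langle>m, u\<^sub>b\<rangle> b\<close> forces every \<open>\<langle>m, u\<^sub>b\<rangle>\<close>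
  to vanish, so that the \<open>u\<^sub>b\<close> themselves are annihilated by \<open>P\<close>.
\<close>

lemma gamma_lattice_annihilator:
  "(gamma_lattice pair {u. \<forall>m\<in>P. pair m u = 0} :: ('m \<Rightarrow> 'g) set) =
    {v \<in> gammaN pair. \<forall>m\<in>P. v m = 0}"
proof (intro equalityI subsetI)
  fix v :: "'m \<Rightarrow> 'g"
  assume "v \<in> gamma_lattice pair {u. \<forall>m\<in>P. pair m u = 0}"
  then obtain k :: nat and u \<gamma> where v: "v = (\<lambda>m. \<Sum>i<k. zmult (pair m (u i)) (\<gamma> i))"
    "\<And>i. i < k \<Longrightarrow> u i \<in> {u. \<forall>m\<in>P. pair m u = 0}"
    by (rule gamma_latticeE) blast
  have "v \<in> gammaN pair"
    unfolding v by (intro gamma_lattice_sumI) auto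
  moreover have "\<forall>m\<in>P. v m = 0"
    using v(2) by (simp add: v(1))
  ultimately show "v \<in> {v \<in> gammaN pair. \<forall>m\<in>P. v m = 0}" by simp
next
  fix v :: "'m \<Rightarrow> 'g"
  assume v0: "v \<in> {v \<in> gammaN pair. \<forall>m\<in>P. v m = 0}"
  then have "v \<in> gammaN pair" by simp
  then obtain k :: nat and u \<gamma> where v: "v = (\<lambda>m. \<Sum>i<k. zmult (pair m (u i)) (\<gamma> i))"
    by (rule gamma_latticeE)
  obtain B where B: "finite B" "zmod.independent B" "\<gamma> ` {..<k} \<subseteq> zmod.span B"
    using finite_subset_span_independent[of "\<gamma> ` {..<k}"] by auto
  let ?r = "\<lambda>i. zmod.representation B (\<gamma> i)"
  let ?u = "\<lambda>b. \<Sum>i<k. zmult (?r i b) (u i)"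
  have \<gamma>: "\<gamma> i = (\<Sum>b\<in>B. zmult (?r i b) b)" if "i < k" for i
    using B that by (intro zmod.sum_representation_eq[symmetric]) auto
  have v': "v m = (\<Sum>b\<in>B. zmult (pair m (?u b)) b)" for m
  proof -
    have "v m = (\<Sum>i<k. zmult (pair m (u i)) (\<Sum>b\<in>B. zmult (?r i b) b))"
      unfolding v by (intro sum.cong refl arg_cong2[where f = zmult] \<gamma>) auto
    also have "\<dots> = (\<Sum>i<k. \<Sum>b\<in>B. zmult (pair m (u i) * ?r i b) b)"
      by (simp add: zmod.scale_sum_right)
    also have "\<dots> = (\<Sum>b\<in>B. \<Sum>i<k. zmult (pair m (u i) * ?r i b) b)"
      by (rule sum.swap)
    also have "\<dots> = (\<Sum>b\<in>B. zmult (pair m (?u b)) b)"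
      by (simp add: pair_sum pair_zmult zmod.scale_sum_left mult.commute)
    finally show ?thesis .
  qed
  have "?u b \<in> {u. \<forall>m\<in>P. pair m u = 0}" if "b \<in> B" for b
  proof -
    have "pair m (?u b) = 0" if "m \<in> P" for m
    proof (rule zmod.independentD[OF B(2) B(1) order.refl _ \<open>b \<in> B\<close>])
      show "(\<Sum>b\<in>B. zmult (pair m (?u b)) b) = 0"
        using v'[of m] v0 that by simp
    qed
    then show ?thesis by simp
  qed
  then have "(\<lambda>m. \<Sum>b\<in>B. zmult (pair m (?u b)) b) \<in> gamma_lattice pair {u. \<forall>m\<in>P. pair m u = 0}"
    using B by (intro gamma_lattice_sumI) auto
  then show "v \<in> gamma_lattice pair {u. \<forall>m\<in>P. pair m u = 0}"
    by (simp only: v'[symmetric])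
qed

text \<open>
  Recovers a saturated \<open>L\<close> from \<open>\<Gamma>\<^sub>L\<close>. A coordinate \<open>b\<close> with \<open>(\<gamma>\<^sub>0)\<^sub>b \<noteq> 0\<close> turns \<open>\<gamma>\<^sub>0 \<otimes> u\<^sub>0 = \<Sum> \<gamma>\<^sub>i \<otimes> u\<^sub>i\<close>
  into \<open>(\<gamma>\<^sub>0)\<^sub>b u\<^sub>0 = \<Sum> (\<gamma>\<^sub>i)\<^sub>b u\<^sub>i\<close>, so a nonzero multiple of \<open>u\<^sub>0\<close> lies in \<open>L\<close>.
\<close>

lemma tensor_in_gamma_lattice_iff:
  assumes L: "saturated_sublattice L" and "\<gamma>0 \<noteq> (0 :: 'g)"
  shows "(\<lambda>m. zmult (pair m u0) \<gamma>0) \<in> gamma_lattice pair L \<longleftrightarrow> u0 \<in> L"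
proof
  assume "(\<lambda>m. zmult (pair m u0) \<gamma>0) \<in> gamma_lattice pair L"
  then obtain k :: nat and u \<gamma> where eq: "(\<lambda>m. zmult (pair m u0) \<gamma>0) = (\<lambda>m. \<Sum>i<k. zmult (pair m (u i)) (\<gamma> i))"
    and u: "\<And>i. i < k \<Longrightarrow> u i \<in> L"
    by (rule gamma_latticeE) blast
  have "finite (insert \<gamma>0 (\<gamma> ` {..<k}))"
    by simp
  from finite_subset_span_independent[OF this]
  obtain B where B: "finite B" "zmod.independent B" "insert \<gamma>0 (\<gamma> ` {..<k}) \<subseteq> zmod.span B"
    by blast
  let ?r = "zmod.representation B"
  have "\<gamma>0 = (\<Sum>b\<in>B. zmult (?r \<gamma>0 b) b)"
    using B by (intro zmod.sum_representation_eq[symmetric]) auto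
  then obtain b where b: "?r \<gamma>0 b \<noteq> 0"
    using \<open>\<gamma>0 \<noteq> 0\<close> by (metis (no_types, lifting) sum.neutral zmod.scale_zero_left)
  have "zmult (?r \<gamma>0 b) u0 - (\<Sum>i<k. zmult (?r (\<gamma> i) b) (u i)) = 0"
  proof (rule pair_nondegenerate)
    fix m
    have "?r (zmult (pair m u0) \<gamma>0) b = ?r (\<Sum>i<k. zmult (pair m (u i)) (\<gamma> i)) b"
      using fun_cong[OF eq, of m] by simp
    moreover have span: "\<gamma>0 \<in> zmod.span B" "i \<in> {..<k} \<Longrightarrow> \<gamma> i \<in> zmod.span B" for i
      using B(3) by auto
    moreover have "?r (\<Sum>i<k. zmult (pair m (u i)) (\<gamma> i)) =
        (\<lambda>b. \<Sum>i<k. ?r (zmult (pair m (u i)) (\<gamma> i)) b)"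
      using span by (intro zmod.representation_sum[OF B(2)] zmod.span_scale)
    ultimately have "pair m u0 * ?r \<gamma>0 b = (\<Sum>i<k. pair m (u i) * ?r (\<gamma> i) b)"
      by (simp add: zmod.representation_scale[OF B(2)])
    then show "pair m (zmult (?r \<gamma>0 b) u0 - (\<Sum>i<k. zmult (?r (\<gamma> i) b) (u i))) = 0"
      by (simp add: pair_diff pair_sum pair_zmult mult.commute)
  qed
  moreover have "(\<Sum>i<k. zmult (?r (\<gamma> i) b) (u i)) \<in> L"
    using L u by (auto simp: saturated_sublattice_def intro!: zmod.subspace_sum zmod.subspace_scale)
  ultimately show "u0 \<in> L"
    using L b by (auto simp: saturated_sublattice_def)
qed (rule gamma_lattice_tensor)

lemma saturated_sublattice_eqI:
  assumes "saturated_sublattice L" "saturated_sublattice L'"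
    and "(gamma_lattice pair L :: ('m \<Rightarrow> 'g) set) = gamma_lattice pair L'"
  shows "L = L'"
proof -
  obtain \<gamma>0 :: 'g where "\<gamma>0 \<noteq> 0"
    using exists_pos by (metis less_irrefl)
  then show ?thesis
    using tensor_in_gamma_lattice_iff[OF assms(1), of \<gamma>0] tensor_in_gamma_lattice_iff[OF assms(2), of \<gamma>0]
      assms(3) by auto
qed

text \<open>
  The lattice of vectors annihilated by every \<open>m\<close> that is constant on \<open>\<sigma>\<close> has the defining property of
  \<open>\<langle>\<sigma>\<rangle>\<close>, and a saturated lattice with this property is unique.
\<close>

lemma linear_lattice_eq:
  fixes \<sigma> :: "('m \<Rightarrow> 'g) set"
  assumes "\<sigma> \<subseteq> gammaN pair"
  shows "linear_lattice pair \<sigma> = {u. \<forall>m\<in>{m. \<forall>w\<in>\<sigma>. \<forall>w'\<in>\<sigma>. w m = w' m}. pair m u = 0}"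
    (is "_ = ?L")
    and "gamma_lattice pair (linear_lattice pair \<sigma>) =
      {v \<in> gammaN pair. \<forall>m. (\<forall>w\<in>\<sigma>. \<forall>w'\<in>\<sigma>. w m = w' m) \<longrightarrow> v m = (0 :: 'g)}"
proof -
  let ?Q = "\<lambda>V. \<exists>m. V = {v \<in> gammaN pair. v m = (0 :: 'g)} \<and> (\<forall>w\<in>\<sigma>. \<forall>w'\<in>\<sigma>. (\<lambda>i. w i - w' i) \<in> V)"
  have diff: "(\<lambda>i. w i - w' i) \<in> gammaN pair" if "w \<in> \<sigma>" "w' \<in> \<sigma>" for w w'
    using that assms by (intro gamma_lattice_diff) auto
  have Q0: "(\<forall>w\<in>\<sigma>. \<forall>w'\<in>\<sigma>. (\<lambda>i. w i - w' i) \<in> {v \<in> gammaN pair. v m = 0}) \<longleftrightarrow>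
      (\<forall>w\<in>\<sigma>. \<forall>w'\<in>\<sigma>. w m = w' m)" for m
    using diff by simp
  have Q: "?Q V \<longleftrightarrow> (\<exists>m. V = {v \<in> gammaN pair. v m = 0} \<and> (\<forall>w\<in>\<sigma>. \<forall>w'\<in>\<sigma>. w m = w' m))" for V
  proof (intro ex_cong1 conj_cong refl)
    fix m assume "V = {v \<in> gammaN pair. v m = 0}"
    then show "(\<forall>w\<in>\<sigma>. \<forall>w'\<in>\<sigma>. (\<lambda>i. w i - w' i) \<in> V) \<longleftrightarrow> (\<forall>w\<in>\<sigma>. \<forall>w'\<in>\<sigma>. w m = w' m)"
      using Q0[of m] by (simp only:)
  qed
  have "w 0 = 0" if "w \<in> \<sigma>" for w
    using gamma_lattice_additive[of w UNIV 0 0] that assms by auto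
  then have "\<forall>w\<in>\<sigma>. \<forall>w'\<in>\<sigma>. w 0 = w' 0"
    by metis
  then have "0 \<in> {m. \<forall>w\<in>\<sigma>. \<forall>w'\<in>\<sigma>. w m = w' m}"
    by simp
  then have "\<Inter>{V. ?Q V} = {v \<in> gammaN pair. \<forall>m\<in>{m. \<forall>w\<in>\<sigma>. \<forall>w'\<in>\<sigma>. w m = w' m}. v m = 0}"
    unfolding Q by blast
  also have "\<dots> = gamma_lattice pair ?L"
    by (rule gamma_lattice_annihilator[symmetric])
  finally have L: "gamma_lattice pair ?L = \<Inter>{V. ?Q V}" ..
  show eq: "linear_lattice pair \<sigma> = ?L"
    unfolding linear_lattice_def
  proof (rule the_equality)
    show "saturated_sublattice ?L \<and> gamma_lattice pair ?L = \<Inter>{V. ?Q V}"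
      using L saturated_annihilator by blast
    show "L = ?L" if "saturated_sublattice L \<and> gamma_lattice pair L = \<Inter>{V. ?Q V}" for L
    proof (rule saturated_sublattice_eqI)
      show "saturated_sublattice L"
        using that by (rule conjunct1)
      show "(gamma_lattice pair L :: ('m \<Rightarrow> 'g) set) = gamma_lattice pair ?L"
        unfolding L by (rule conjunct2[OF that])
    qed (rule saturated_annihilator)
  qed
  show "gamma_lattice pair (linear_lattice pair \<sigma>) =
      {v \<in> gammaN pair. \<forall>m. (\<forall>w\<in>\<sigma>. \<forall>w'\<in>\<sigma>. w m = w' m) \<longrightarrow> v m = (0 :: 'g)}"
    unfolding eq gamma_lattice_annihilator by simp
qed

lemma difference_in_gamma_lattice:
  fixes \<sigma> :: "('m \<Rightarrow> 'g) set"
  assumes "\<sigma> \<subseteq> gammaN pair" "w \<in> \<sigma>" "w' \<in> \<sigma>"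
  shows "(\<lambda>m. w m - w' m) \<in> gamma_lattice pair (linear_lattice pair \<sigma>)"
  unfolding linear_lattice_eq(2)[OF assms(1)] using assms
  by (auto intro!: gamma_lattice_diff)

text \<open>
  An inequality of \<open>\<sigma>\<close> that is an equality at \<open>w\<close> is one on all of \<open>\<sigma>\<close>, since \<open>w\<close> lies on no proper face, and
  \<open>u\<close> is orthogonal to it. The other inequalities survive a small move. Hence \<open>w + 2\<delta> \<otimes> u\<close> still lies in
  \<open>\<sigma>\<close>; if \<open>w + \<delta> \<otimes> u\<close> were on a proper face, then \<open>w + 2\<delta> \<otimes> u\<close> would be on the wrong side of the hyperplane
  cutting out that face.
\<close>

lemma relint_perturbation:
  fixes \<sigma> :: "('m \<Rightarrow> 'g) set"
  assumes \<sigma>: "polyhedron pair \<sigma>" and w: "w \<in> relint \<sigma>" and u: "u \<in> linear_lattice pair \<sigma>"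
  shows "\<exists>\<epsilon>>0. \<forall>\<delta>. 0 < \<delta> \<and> \<delta> \<le> \<epsilon> \<longrightarrow> (\<lambda>m. w m + zmult (pair m u) \<delta>) \<in> relint \<sigma>"
proof -
  obtain H where H: "finite H" "\<sigma> = {w \<in> gammaN pair. \<forall>(m, a)\<in>H. a \<le> w m}"
    using \<sigma> by (auto simp: polyhedron_def)
  have face: "F = \<sigma>" if "face_of_polyhedron F \<sigma>" "w \<in> F" for F
    using w that by (auto simp: relint_def)
  have "w \<in> \<sigma>" using w by (simp add: relint_def)
  have flat: "pair m u = 0" if "(m, a) \<in> H" "w m = a" for m a
  proof -
    have "\<forall>x\<in>\<sigma>. a \<le> x m" "{x \<in> \<sigma>. x m = a} \<noteq> {}"
      using that \<open>w \<in> \<sigma>\<close> H(2) by auto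
    then have "face_of_polyhedron {x \<in> \<sigma>. x m = a} \<sigma>"
      unfolding face_of_polyhedron_def by blast
    then have "{x \<in> \<sigma>. x m = a} = \<sigma>"
      using that \<open>w \<in> \<sigma>\<close> by (intro face) auto
    then have "\<forall>x\<in>\<sigma>. \<forall>x'\<in>\<sigma>. x m = x' m"
      by (metis (mono_tags, lifting) mem_Collect_eq)
    moreover have "\<sigma> \<subseteq> gammaN pair" by (auto simp: H)
    ultimately show ?thesis
      using u by (simp add: linear_lattice_eq)
  qed
  let ?E = "(\<lambda>(m, a). w m - a) ` {(m, a) \<in> H. w m \<noteq> a}"
  let ?Z = "(\<lambda>(m, a). pair m u) ` H"
  have "\<exists>\<epsilon>>0. \<forall>\<delta>. 0 < \<delta> \<and> \<delta> \<le> \<epsilon> \<longrightarrow> (\<forall>j\<in>?Z. \<forall>e\<in>?E. 0 < e + zmult j \<delta>)"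
  proof (rule small_multiples)
    show "finite ?E"
      using H(1) by (intro finite_imageI finite_subset[OF _ H(1)]) auto
    show "finite ?Z" using H(1) by simp
    show "0 < e" if "e \<in> ?E" for e
      using that \<open>w \<in> \<sigma>\<close> unfolding H(2) by (force simp: less_le)
  qed
  then obtain \<epsilon>1 where \<epsilon>1: "0 < \<epsilon>1"
    "\<And>\<delta> j e. 0 < \<delta> \<Longrightarrow> \<delta> \<le> \<epsilon>1 \<Longrightarrow> j \<in> ?Z \<Longrightarrow> e \<in> ?E \<Longrightarrow> 0 < e + zmult j \<delta>"
    by blast
  have in_\<sigma>: "(\<lambda>m. w m + zmult (pair m u) \<delta>) \<in> \<sigma>" if \<delta>: "0 < \<delta>" "\<delta> \<le> \<epsilon>1" for \<delta>
  proof -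
    have "a \<le> w m + zmult (pair m u) \<delta>" if "(m, a) \<in> H" for m a
    proof (cases "w m = a")
      case True
      then show ?thesis using flat[OF that] by simp
    next
      case False
      then have "0 < (w m - a) + zmult (pair m u) \<delta>"
        using that by (intro \<epsilon>1(2)[OF \<delta>]) force+
      then show ?thesis by (simp add: algebra_simps)
    qed
    moreover have "(\<lambda>m. w m + zmult (pair m u) \<delta>) \<in> gammaN pair"
      using \<open>w \<in> \<sigma>\<close> unfolding H(2) by (intro gamma_lattice_add gamma_lattice_tensor) auto
    ultimately show ?thesis
      unfolding H(2) by auto
  qed
  obtain \<epsilon> where \<epsilon>: "zmult 2 \<epsilon> = \<epsilon>1"
    using val_group_divisible[of 2] by auto
  have two: "zmult 2 x = x + x" for x :: 'g
    using zmod.scale_left_distrib[of 1 1 x] by simp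
  have "0 < \<epsilon>"
  proof (rule ccontr)
    assume "\<not> 0 < \<epsilon>"
    then have "\<epsilon> + \<epsilon> \<le> 0"
      by (intro add_nonpos_nonpos) auto
    then show False
      using \<epsilon> \<epsilon>1(1) by (metis two leD)
  qed
  moreover have "(\<lambda>m. w m + zmult (pair m u) \<delta>) \<in> relint \<sigma>" if \<delta>: "0 < \<delta>" "\<delta> \<le> \<epsilon>" for \<delta>
  proof -
    let ?w = "\<lambda>m. w m + zmult (pair m u) \<delta>"
    have le: "\<delta> \<le> \<epsilon>1" "\<delta> + \<delta> \<le> \<epsilon>1" "0 < \<delta> + \<delta>"
      using \<delta> \<epsilon> \<open>0 < \<epsilon>\<close> by (auto simp: two add_mono add_pos_pos intro: order.trans[of _ "\<epsilon> + \<epsilon>"] add_increasing)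
    have "F = \<sigma>" if F: "face_of_polyhedron F \<sigma>" "?w \<in> F" for F
    proof (rule ccontr)
      assume "F \<noteq> \<sigma>"
      then obtain m a where ma: "\<forall>x\<in>\<sigma>. a \<le> x m" "F = {x \<in> \<sigma>. x m = a}"
        using F by (auto simp: face_of_polyhedron_def)
      have "w \<notin> F"
        using face[OF F(1)] \<open>F \<noteq> \<sigma>\<close> by blast
      then have "a < w m"
        using ma \<open>w \<in> \<sigma>\<close> by (auto simp: less_le)
      have on_face: "w m + zmult (pair m u) \<delta> = a"
        using F(2) ma by simp
      have "a \<le> w m + zmult (pair m u) (\<delta> + \<delta>)"
        using bspec[OF ma(1) in_\<sigma>[OF le(3,2)]] by simp
      also have "\<dots> = (w m + zmult (pair m u) \<delta>) + zmult (pair m u) \<delta>"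
        by (simp add: zmod.scale_right_distrib add.assoc)
      also have "\<dots> = a + zmult (pair m u) \<delta>"
        by (simp only: on_face)
      finally have "w m \<le> w m + zmult (pair m u) \<delta>"
        by simp
      then show False
        using on_face \<open>a < w m\<close> by simp
    qed
    then show ?thesis
      using in_\<sigma>[OF \<delta>(1) le(1)] by (auto simp: relint_def)
  qed
  ultimately show ?thesis by blast
qed

end

section \<open>Dehomogenization\<close>

text \<open>
  The exponent in \<open>M\<close> of a monomial in \<open>x\<^sub>0, \<dots>, x\<^sub>n\<close> at \<open>x\<^sub>0 = 1\<close>, so that \<open>push (dehom n e)\<close> is
  dehomogenization.
\<close>

definition dehom :: "nat \<Rightarrow> (nat \<Rightarrow> 'm::ab_group_add) \<Rightarrow> (nat \<Rightarrow>\<^sub>0 nat) \<Rightarrow> 'm" where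
  "dehom n e \<mu> = (\<Sum>i = 1..n. zmult (int (lookup \<mu> i)) (e i))"

lemma additive_map_dehom: "additive_map (dehom n e)"
  by (simp add: additive_map_def dehom_def lookup_add zmod.scale_left_distrib sum.distrib)

lemma poly_to_laurent_eq_push:
  assumes "p \<in> polys_in {1..n}"
  shows "poly_to_laurent e p = push (dehom n e) p"
proof -
  have "(\<Sum>i\<in>keys \<mu>. zmult (int (lookup \<mu> i)) (e i)) = dehom n e \<mu>" if "\<mu> \<in> keys p" for \<mu>
    unfolding dehom_def using that assms
    by (intro sum.mono_neutral_left) (auto simp: polys_in_def in_keys_iff)
  then show ?thesis
    by (simp add: poly_to_laurent_def push_def)
qed

lemma homogenize_eq_push:
  "homogenize p = push (\<lambda>\<mu>. \<mu> + single 0 (Max (total_deg ` keys p) - total_deg \<mu>)) p"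
  by (simp add: homogenize_def push_def)

lemma dehom_add_single_zero: "dehom n e (\<mu> + single 0 c) = dehom n e \<mu>"
  by (simp add: dehom_def lookup_add lookup_single when_def)

lemma push_dehom_homogenize: "push (dehom n e) (homogenize p) = push (dehom n e) p"
  by (simp add: homogenize_eq_push push_push dehom_add_single_zero)

lemma homogenize_in_polys_in:
  assumes "p \<in> polys_in {1..n}"
  shows "homogenize p \<in> polys_in {0..n}"
proof -
  have "keys (\<mu> + single 0 c) \<subseteq> {0..n}" if "\<mu> \<in> keys p" for \<mu> and c :: nat
    using that assms keys_add[of \<mu> "single 0 c"] by (fastforce simp: polys_in_def split: if_splits)
  then show ?thesis
    unfolding polys_in_def homogenize_eq_push using keys_push by fastforce
qed

lemma exponents_add_closed:
  "\<mu> \<in> {\<mu>. keys \<mu> \<subseteq> V} \<Longrightarrow> \<mu>' \<in> {\<mu>. keys \<mu> \<subseteq> V} \<Longrightarrow> \<mu> + \<mu>' \<in> {\<mu> :: nat \<Rightarrow>\<^sub>0 nat. keys \<mu> \<subseteq> V}"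
  using keys_add[of \<mu> \<mu>'] by auto

lemma ideal_in_polys_in: "ideal_in (polys_in V) (polys_in V :: ((nat \<Rightarrow>\<^sub>0 nat) \<Rightarrow>\<^sub>0 'f::comm_ring_1) set)"
  unfolding polys_in_eq_supported by (intro ideal_in_supported exponents_add_closed)

lemma ideal_in_homogenized_ideal:
  "ideal_in (polys_in {0..n}) (homogenized_ideal n e I)"
  unfolding homogenized_ideal_def
  by (intro ideal_in_generated ideal_in_polys_in) (auto intro: homogenize_in_polys_in)

lemma homogenize_in_homogenized_ideal:
  "p \<in> polys_in {1..n} \<Longrightarrow> push (dehom n e) p \<in> I \<Longrightarrow> homogenize p \<in> homogenized_ideal n e I"
  unfolding homogenized_ideal_def
  by (intro subsetD[OF generators_subset_ideal_generated] imageI) (simp add: poly_to_laurent_eq_push)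

lemma dehomogenize_homogenized_ideal:
  assumes I: "ideal_in UNIV I" and F: "F \<in> homogenized_ideal n e I"
  shows "push (dehom n e) F \<in> I"
proof -
  let ?S = "homogenize ` {p \<in> polys_in {1..n}. poly_to_laurent e p \<in> I}"
  let ?J = "{F \<in> polys_in {0..n}. push (dehom n e) F \<in> I}"
  have "ideal_in (polys_in {0..n}) ?J"
    using ideal_inD[OF I] ideal_inD[OF ideal_in_polys_in]
    by (auto simp: ideal_in_def push_add push_mult[OF additive_map_dehom])
  moreover have "?S \<subseteq> ?J"
    by (auto simp: push_dehom_homogenize poly_to_laurent_eq_push intro: homogenize_in_polys_in)
  ultimately have "homogenized_ideal n e I \<subseteq> ?J"
    unfolding homogenized_ideal_def by (rule ideal_generated_least)
  then show ?thesis
    using F by auto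
qed

lemma zbasis_coordinates:
  fixes e :: "nat \<Rightarrow> 'm::ab_group_add"
  assumes "inj_on e {1..n}" "zbasis (e ` {1..n})"
  shows "\<exists>c. m = (\<Sum>i = 1..n. zmult (c i) (e i))"
proof -
  have "m \<in> zmod.span (e ` {1..n})"
    using assms by (simp add: zbasis_def)
  then have "m \<in> range (\<lambda>c. \<Sum>v\<in>e ` {1..n}. zmult (c v) v)"
    by (simp only: zmod.span_finite finite_imageI finite_atLeastAtMost)
  then obtain c where "m = (\<Sum>v\<in>e ` {1..n}. zmult (c v) v)"
    by (rule rangeE)
  then have "m = (\<Sum>i = 1..n. zmult (c (e i)) (e i))"
    using assms by (simp add: sum.reindex)
  then show ?thesis
    by (rule exI[of _ "\<lambda>i. c (e i)"])
qed

text \<open>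
  Finitely many Laurent monomials become monomials in \<open>x\<^sub>1, \<dots>, x\<^sub>n\<close> after multiplication by a large power
  of \<open>x\<^sub>1 \<cdots> x\<^sub>n\<close>.
\<close>

lemma positive_exponents:
  fixes e :: "nat \<Rightarrow> 'm::ab_group_add"
  assumes basis: "inj_on e {1..n}" "zbasis (e ` {1..n})" and "finite S"
  shows "\<exists>k \<psi>. \<forall>m\<in>S. keys (\<psi> m) \<subseteq> {1..n} \<and> dehom n e (\<psi> m) = m + k"
proof -
  obtain c where c: "m = (\<Sum>i = 1..n. zmult (c m i) (e i))" for m
    using zbasis_coordinates[OF basis] by metis
  \<comment> \<open>Large enough to make all coordinates \<open>c m i + K\<close> nonnegative.\<close>
  define K where "K = Max (insert 0 ((\<lambda>(m, i). - c m i) ` (S \<times> {1..n})))"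
  have K: "0 \<le> c m i + K" if "m \<in> S" "i \<in> {1..n}" for m i
  proof -
    have "- c m i \<le> K"
      unfolding K_def using that \<open>finite S\<close> by (intro Max_ge) force+
    then show ?thesis by simp
  qed
  define \<psi> where "\<psi> m = (\<Sum>i = 1..n. single i (nat (c m i + K)))" for m
  have lookup_\<psi>: "lookup (\<psi> m) i = (if i \<in> {1..n} then nat (c m i + K) else 0)" for m i
    by (auto simp: \<psi>_def lookup_sum lookup_single when_def)
  have "dehom n e (\<psi> m) = m + (\<Sum>i = 1..n. zmult K (e i))" if "m \<in> S" for m
  proof -
    have "dehom n e (\<psi> m) = (\<Sum>i = 1..n. zmult (c m i + K) (e i))"
      unfolding dehom_def by (intro sum.cong) (use K that in \<open>simp_all add: lookup_\<psi>\<close>)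
    also have "\<dots> = m + (\<Sum>i = 1..n. zmult K (e i))"
      using c[of m] by (simp add: zmod.scale_left_distrib sum.distrib)
    finally show ?thesis .
  qed
  moreover have "keys (\<psi> m) \<subseteq> {1..n}" for m
    by (auto simp: in_keys_iff lookup_\<psi> split: if_splits)
  ultimately show ?thesis by blast
qed

section \<open>Tropical reductions and the Groebner complex\<close>

locale tropical_setting = valued_residue \<nu> red + valued_lattice \<nu> pair
  for \<nu> :: "'k::alg_closed_field \<Rightarrow> 'g::linordered_ab_group_add"
    and red :: "'k \<Rightarrow> 'r::field"
    and pair :: "'m::ab_group_add \<Rightarrow> 'n::ab_group_add \<Rightarrow> int"
begin

lemma additive_gammaN: "w \<in> gammaN pair \<Longrightarrow> additive w"
  by unfold_locales (rule gamma_lattice_additive)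

lemma additive_map_gammaN: "w \<in> gammaN pair \<Longrightarrow> additive_map w"
  by (simp add: additive_map_def gamma_lattice_additive)

text \<open>
  The weight of a monomial in \<open>x\<^sub>0, \<dots>, x\<^sub>n\<close> is that of its dehomogenization, as \<open>x\<^sub>0\<close> has weight \<open>0\<close>.
\<close>

lemma poly_weight_eq:
  assumes "w \<in> gammaN pair"
  shows "poly_weight n e w = (\<lambda>\<mu>. w (dehom n e \<mu>))"
  by (simp add: poly_weight_def dehom_def fun_eq_iff additive.sum[OF additive_gammaN[OF assms]]
      additive_zmult[OF additive_gammaN[OF assms]])

lemma tropical_reduction_eq_reductions:
  assumes "valuation_section \<nu> s" "w \<in> gammaN pair" "ideal_in UNIV I"
  shows "tropical_reduction \<nu> red s w I = reductions s w I"
  unfolding tropical_reduction_def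
  using ideal_generated_initial_forms[OF assms(1) additive_map_gammaN[OF assms(2)], of UNIV I] assms(3)
  by (simp add: UNIV_eq_supported[symmetric])

lemma initial_ideal_eq_reductions:
  assumes s: "valuation_section \<nu> s" and w: "w \<in> gammaN pair"
    and J: "ideal_in (polys_in {0..n}) J"
  shows "initial_ideal \<nu> red s n e w J = reductions s (\<lambda>\<mu>. w (dehom n e \<mu>)) J"
proof -
  have "additive_map (\<lambda>\<mu>. w (dehom n e \<mu>))"
    using additive_map_gammaN[OF w] additive_map_dehom[of n e] by (simp add: additive_map_def)
  from ideal_generated_initial_forms[OF s this J[unfolded polys_in_eq_supported]]
  show ?thesis
    unfolding initial_ideal_def polys_in_eq_supported poly_weight_eq[OF w] by simp
qed

lemma dehomogenize_reductions:
  assumes I: "ideal_in UNIV I"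
    and H: "H \<in> reductions s (\<lambda>\<mu>. w (dehom n e \<mu>)) (homogenized_ideal n e I)"
  shows "push (dehom n e) H \<in> reductions s w I"
proof -
  obtain F where F: "F \<in> homogenized_ideal n e I" "reduces s (\<lambda>\<mu>. w (dehom n e \<mu>)) F H"
    using H by (auto simp: reductions_def)
  have "reduces s w (push (dehom n e) F) (push (dehom n e) H)"
    by (rule reduces_push[OF F(2)]) simp
  then show ?thesis
    using dehomogenize_homogenized_ideal[OF I F(1)] by (auto simp: reductions_def)
qed

text \<open>
  Up to a monomial factor every element of the initial ideal of \<open>I\<close> comes from the initial ideal of the
  homogenization: multiply \<open>f \<in> I\<close> into \<open>K[x\<^sub>1, \<dots>, x\<^sub>n]\<close> and homogenize. Both steps only relabel monomials by
  ones of the same weight, apart from a constant factor, so the same relabelling carries the reduction of \<open>f\<close>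
  to that of the homogenized polynomial.
\<close>

lemma reductions_from_homogenized:
  assumes s: "valuation_section \<nu> s" and w: "w \<in> gammaN pair" and I: "ideal_in UNIV I"
    and basis: "inj_on e {1..n}" "zbasis (e ` {1..n})" and g: "g \<in> reductions s w I"
  shows "\<exists>k. \<exists>H\<in>reductions s (\<lambda>\<mu>. w (dehom n e \<mu>)) (homogenized_ideal n e I).
    single k 1 * g = push (dehom n e) H"
proof -
  obtain f where f: "f \<in> I" "reduces s w f g"
    using g by (auto simp: reductions_def)
  obtain k \<psi>0 where \<psi>0: "\<And>m. m \<in> keys f \<Longrightarrow> keys (\<psi>0 m) \<subseteq> {1..n} \<and> dehom n e (\<psi>0 m) = m + k"
    using positive_exponents[OF basis finite_keys[of f]] by blast
  \<comment> \<open>The factor \<open>s (- w k)\<close> compensates the weight of the monomial \<open>k\<close>.\<close>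
  define f' where "f' = single k (s (- w k)) * f"
  define g' where "g' = single k 1 * g"
  have "reduces s w (single k (s (- w k))) (single k 1)"
    using section_nonzero[OF s] by (intro reduces_single) (simp_all add: section_minus[OF s] red_one)
  then have red': "reduces s w f' g'"
    unfolding f'_def g'_def by (intro reduces_mult[OF s additive_map_gammaN[OF w]] f)
  have "f' \<in> I"
    unfolding f'_def using f by (intro ideal_inD(4)[OF I]) auto
  define \<psi> where "\<psi> m = \<psi>0 (m - k)" for m
  have \<psi>: "keys (\<psi> m) \<subseteq> {1..n}" "dehom n e (\<psi> m) = m" if "m \<in> keys f'" for m
  proof -
    have "keys f' \<subseteq> {i + j |i j. i \<in> keys (single k (s (- w k))) \<and> j \<in> keys f}"
      unfolding f'_def by (rule keys_mult)
    then obtain j where "m = k + j" "j \<in> keys f"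
      using \<open>m \<in> keys f'\<close> by (auto split: if_splits)
    then show "keys (\<psi> m) \<subseteq> {1..n}" "dehom n e (\<psi> m) = m"
      using \<psi>0[of j] by (auto simp: \<psi>_def add.commute)
  qed
  define p where "p = push \<psi> f'"
  have "p \<in> polys_in {1..n}"
    using keys_push[of \<psi> f'] \<psi>(1) by (auto simp: p_def polys_in_def)
  moreover have "push (dehom n e) p = f'"
    using push_cong[of f' "\<lambda>m. dehom n e (\<psi> m)" "\<lambda>m. m"] \<psi>(2)
    by (simp add: p_def push_push push_id)
  ultimately have F: "homogenize p \<in> homogenized_ideal n e I"
    using \<open>f' \<in> I\<close> by (intro homogenize_in_homogenized_ideal) auto
  \<comment> \<open>The monomial map \<open>\<psi>\<close> followed by homogenization.\<close>
  define \<theta> where "\<theta> m = \<psi> m + single 0 (Max (total_deg ` keys p) - total_deg (\<psi> m))" for m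
  have \<theta>: "dehom n e (\<theta> m) = m" if "m \<in> keys f'" for m
    using \<psi>(2)[OF that] by (simp add: \<theta>_def dehom_add_single_zero)
  have "homogenize p = push \<theta> f'"
    unfolding homogenize_eq_push by (simp add: p_def push_push \<theta>_def[abs_def])
  moreover have "reduces s (\<lambda>\<mu>. w (dehom n e \<mu>)) (push \<theta> f') (push \<theta> g')"
    by (rule reduces_push[OF red']) (simp add: \<theta>)
  ultimately have "push \<theta> g' \<in> reductions s (\<lambda>\<mu>. w (dehom n e \<mu>)) (homogenized_ideal n e I)"
    using F by (auto simp: reductions_def)
  moreover have "push (dehom n e) (push \<theta> g') = g'"
    using push_cong[of g' "\<lambda>m. dehom n e (\<theta> m)" "\<lambda>m. m"] \<theta> keys_reduces[OF red']
    by (simp add: push_push push_id subset_iff)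
  ultimately show ?thesis
    unfolding g'_def by metis
qed

text \<open>
  By the definition of the Groebner complex the initial ideal of the homogenization is constant on the
  relative interior of \<open>\<phi>\<close>, so it is invariant under the one-parameter subgroup of \<open>u\<close>. The initial ideal of
  \<open>I\<close> inherits this, since monomials are units in the Laurent ring.
\<close>

lemma reductions_graded:
  assumes s: "valuation_section \<nu> s" and I: "ideal_in UNIV I"
    and basis: "inj_on e {1..n}" "zbasis (e ` {1..n})"
    and \<G>: "groebner_complex pair \<nu> red s n e (homogenized_ideal n e I) \<G>"
    and \<phi>: "\<phi> \<in> \<G>" "w \<in> relint \<phi>" and u: "u \<in> linear_lattice pair \<phi>" and c: "c \<noteq> 0"
    and g: "g \<in> reductions s w I"
  shows "scale (\<lambda>m. c powi pair m u) g \<in> reductions s w I"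
proof -
  let ?J = "homogenized_ideal n e I"
  have poly: "polyhedron pair \<phi>"
    using \<G> \<phi> by (auto simp: groebner_complex_def polyhedral_complex_def)
  have relint: "relint \<phi> \<subseteq> gammaN pair"
    using poly by (auto simp: relint_def polyhedron_def)
  then have w: "w \<in> gammaN pair" using \<phi> by auto
  obtain \<epsilon> where \<epsilon>: "0 < \<epsilon>"
    "\<And>\<delta>. 0 < \<delta> \<Longrightarrow> \<delta> \<le> \<epsilon> \<Longrightarrow> (\<lambda>m. w m + zmult (pair m u) \<delta>) \<in> relint \<phi>"
    using relint_perturbation[OF poly \<phi>(2) u] by blast
  have const: "reductions s (\<lambda>\<mu>. w (dehom n e \<mu>) + zmult (pair (dehom n e \<mu>) u) \<delta>) ?J \<subseteq>
      reductions s (\<lambda>\<mu>. w (dehom n e \<mu>)) ?J" if "0 < \<delta>" "\<delta> \<le> \<epsilon>" for \<delta>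
  proof -
    let ?w = "\<lambda>m. w m + zmult (pair m u) \<delta>"
    have w': "?w \<in> relint \<phi>" "?w \<in> gammaN pair"
      using \<epsilon>(2)[OF that] relint by auto
    have "initial_ideal \<nu> red s n e ?w ?J = initial_ideal \<nu> red s n e w ?J"
      using \<G> w w' \<phi> unfolding groebner_complex_def by blast
    then show ?thesis
      unfolding initial_ideal_eq_reductions[OF s w'(2) ideal_in_homogenized_ideal]
        initial_ideal_eq_reductions[OF s w ideal_in_homogenized_ideal] by simp
  qed
  obtain k H where H: "H \<in> reductions s (\<lambda>\<mu>. w (dehom n e \<mu>)) ?J"
    "single k 1 * g = push (dehom n e) H"
    using reductions_from_homogenized[OF s w I basis g] by blast
  have "scale (\<lambda>\<mu>. c powi pair (dehom n e \<mu>) u) H \<in> reductions s (\<lambda>\<mu>. w (dehom n e \<mu>)) ?J"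
  proof (rule reductions_scale_invariant[OF s _ _ _ \<epsilon>(1) const H(1)])
    show "additive_map (\<lambda>\<mu>. w (dehom n e \<mu>))"
      using additive_map_gammaN[OF w] additive_map_dehom[of n e] by (simp add: additive_map_def)
    show "ideal_in (supported {\<mu>. keys \<mu> \<subseteq> {0..n}}) ?J"
      using ideal_in_homogenized_ideal unfolding polys_in_eq_supported .
  qed auto
  from dehomogenize_reductions[OF I this]
  have "scale (\<lambda>m. c powi pair m u) (push (dehom n e) H) \<in> reductions s w I"
    by (subst scale_push[where \<chi> = "\<lambda>\<mu>. c powi pair (dehom n e \<mu>) u"]) auto
  moreover have "scale (\<lambda>m. c powi pair m u) (single k 1 * g) =
      single k (c powi pair k u) * scale (\<lambda>m. c powi pair m u) g"
    using c by (subst scale_mult) (simp_all add: pair_add power_int_add scale_single)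
  ultimately have in_red: "single k (c powi pair k u) * scale (\<lambda>m. c powi pair m u) g \<in> reductions s w I"
    by (simp add: H(2))
  have "ideal_in UNIV (reductions s w I)"
    using ideal_in_reductions[OF s additive_map_gammaN[OF w], of UNIV I] I
    by (simp add: UNIV_eq_supported[symmetric])
  from ideal_inD(4)[OF this UNIV_I in_red]
  have "single (- k) (1 / c powi pair k u) *
      (single k (c powi pair k u) * scale (\<lambda>m. c powi pair m u) g) \<in> reductions s w I"
    by blast
  then show ?thesis
    using c by (simp add: mult.assoc[symmetric] mult_single)
qed

text \<open>
  Rescalings of the monomials commute with each other, in particular with the one that relates the
  initial ideals for \<open>s\<close> and \<open>t\<close>. So invariance for the section used to build the complex gives it for any
  other section.
\<close>

lemma scale_invariance_change_section:
  assumes s: "valuation_section \<nu> s" and t: "valuation_section \<nu> t"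
    and inv: "\<And>g. g \<in> reductions s w I \<Longrightarrow> scale \<chi> g \<in> reductions s w I"
    and g: "g \<in> reductions t w I"
  shows "scale \<chi> g \<in> reductions t w I"
proof -
  let ?r = "\<lambda>m. residue_ratio s t (w m)"
  have "scale \<chi> (scale ?r g) \<in> reductions s w I"
    using g by (intro inv) (simp add: reductions_change_section[OF t s])
  moreover have "scale \<chi> (scale ?r g) = scale ?r (scale \<chi> g)"
    by (rule poly_mapping_eqI) (simp add: mult_ac)
  ultimately show ?thesis
    by (simp add: reductions_change_section[OF t s])
qed

text \<open>
  For \<open>v = \<Sum> \<gamma>\<^sub>i \<otimes> u\<^sub>i\<close> the torus point \<open>m \<mapsto> \<beta> (v m)\<close> is the product of the values at \<open>\<beta> \<gamma>\<^sub>i\<close> of the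
  one-parameter subgroups \<open>u\<^sub>i\<close>.
\<close>

lemma scale_invariance_gamma_lattice:
  fixes v :: "'m \<Rightarrow> 'g" and \<beta> :: "'g \<Rightarrow> 'r"
  assumes inv: "\<And>u c g. u \<in> L \<Longrightarrow> c \<noteq> 0 \<Longrightarrow> g \<in> G \<Longrightarrow> scale (\<lambda>m. c powi pair m u) g \<in> G"
    and \<beta>: "\<And>x y. \<beta> (x + y) = \<beta> x * \<beta> y" "\<And>x. \<beta> x \<noteq> 0"
    and v: "v \<in> gamma_lattice pair L" and "g \<in> G"
  shows "scale (\<lambda>m. \<beta> (v m)) g \<in> G"
proof -
  obtain k :: nat and u \<gamma> where v': "v = (\<lambda>m. \<Sum>i<k. zmult (pair m (u i)) (\<gamma> i))"
    "\<And>i. i < k \<Longrightarrow> u i \<in> L"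
    using v by (rule gamma_latticeE) blast
  have "scale (\<lambda>m. \<Prod>i<j. \<beta> (\<gamma> i) powi pair m (u i)) g \<in> G" if "j \<le> k" for j
    using that
  proof (induction j)
    case 0
    have "scale (\<lambda>m. \<Prod>i<0. \<beta> (\<gamma> i) powi pair m (u i)) g = g"
      by (rule poly_mapping_eqI) (simp only: lookup_scale, simp)
    then show ?case using \<open>g \<in> G\<close> by simp
  next
    case (Suc j)
    have "scale (\<lambda>m. \<Prod>i<Suc j. \<beta> (\<gamma> i) powi pair m (u i)) g =
        scale (\<lambda>m. \<beta> (\<gamma> j) powi pair m (u j)) (scale (\<lambda>m. \<Prod>i<j. \<beta> (\<gamma> i) powi pair m (u i)) g)"
      by (rule poly_mapping_eqI) (simp add: mult_ac)
    then show ?case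
      using Suc v'(2) \<beta>(2) by (simp add: inv)
  qed
  from this[of k] show ?thesis
    by (simp add: v'(1) hom_sum[of \<beta>, OF \<beta>] hom_zmult[of \<beta>, OF \<beta>])
qed

lemma hom_gamma_lattice_in_subtorus:
  fixes v :: "'m \<Rightarrow> 'g" and \<beta> :: "'g \<Rightarrow> 'r"
  assumes \<beta>: "\<And>x y. \<beta> (x + y) = \<beta> x * \<beta> y" "\<And>x. \<beta> x \<noteq> 0"
    and v: "v \<in> gamma_lattice pair L"
  shows "(\<lambda>m. \<beta> (v m)) \<in> subtorus_points pair L"
proof -
  obtain k :: nat and u \<gamma> where v': "v = (\<lambda>m. \<Sum>i<k. zmult (pair m (u i)) (\<gamma> i))"
    "\<And>i. i < k \<Longrightarrow> u i \<in> L"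
    using v by (rule gamma_latticeE) blast
  define y where "y \<phi> = (\<Prod>i<k. \<beta> (\<gamma> i) powi \<phi> (u i))" for \<phi>
  have "(\<lambda>m. \<beta> (v m)) = (\<lambda>m. y (\<lambda>x. if x \<in> L then pair m x else 0))"
    using v'(2) by (simp add: v'(1) y_def hom_sum[of \<beta>, OF \<beta>] hom_zmult[of \<beta>, OF \<beta>])
  moreover have "y \<phi> \<noteq> 0" for \<phi>
    using \<beta>(2) by (simp add: y_def)
  moreover have "y (\<lambda>x. \<phi> x + \<psi> x) = y \<phi> * y \<psi>" for \<phi> \<psi>
    using \<beta>(2) by (simp add: y_def power_int_add prod.distrib)
  ultimately show ?thesis
    unfolding subtorus_points_def by blast
qed

end

section \<open>Comparison of the tropical reductions for two sections\<close>

theorem proposition1p8: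
  fixes \<nu> :: "'k::alg_closed_field \<Rightarrow> 'g::linordered_ab_group_add"
    and red :: "'k \<Rightarrow> 'r::field"
    and pair :: "'m::ab_group_add \<Rightarrow> 'n::ab_group_add \<Rightarrow> int"
    and I :: "('m \<Rightarrow>\<^sub>0 'k) set"
    and \<tau> t :: "'g \<Rightarrow> 'k"
    and \<C> :: "('m \<Rightarrow> 'g) set set"
    and p :: "('m \<Rightarrow> 'g) set \<Rightarrow> ('m \<Rightarrow> 'g)"
    and \<alpha> :: "('m \<Rightarrow> 'g) \<Rightarrow> 'm \<Rightarrow> 'k"
    and a :: "('m \<Rightarrow> 'g) set \<Rightarrow> 'm \<Rightarrow> 'r"
  assumes "nonarch_valuation \<nu>"
    and "residue_map \<nu> red"
    and "dual_lattice pair"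
    and "ideal_in UNIV I"
    and "valuation_section \<nu> \<tau>" and "valuation_section \<nu> t"
    and "projectively_induced_complex pair \<nu> red I \<C>"
    and "\<Union>\<C> = tropicalization \<nu> I"
    and "\<And>\<sigma>. \<sigma> \<in> minimal_faces \<C> \<Longrightarrow> p \<sigma> \<in> \<sigma>"
    and "\<And>w m. \<alpha> w m = t (w m) / \<tau> (w m)"
    and "\<And>\<sigma> m. a \<sigma> m = red (\<alpha> (p \<sigma>) m)"
  shows "(\<forall>w \<in> tropicalization \<nu> I. \<forall>\<phi>\<in>\<C>. \<forall>\<sigma> \<in> minimal_faces \<C>.
            w \<in> relint \<phi> \<and> \<sigma> \<subseteq> \<phi> \<longrightarrow>
            tropical_reduction \<nu> red \<tau> w I = translate (a \<sigma>) (tropical_reduction \<nu> red t w I)) \<and>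
         (\<forall>\<rho>\<in>\<C>. \<exists>b\<in>torus_points. a ` {\<sigma> \<in> minimal_faces \<C>. \<sigma> \<subseteq> \<rho>} \<subseteq>
            (\<lambda>y m. b m * y m) ` subtorus_points pair (linear_lattice pair \<rho>))"
proof -
  interpret tropical_setting \<nu> red pair
    using assms(1-3) by (simp add: tropical_setting_def valued_residue_def valued_lattice_def)
  note \<tau> = \<open>valuation_section \<nu> \<tau>\<close> and t = \<open>valuation_section \<nu> t\<close> and I = \<open>ideal_in UNIV I\<close>
  obtain n e s \<G> where basis: "inj_on e {1..n}" "zbasis (e ` {1..n})"
    and s: "valuation_section \<nu> s"
    and \<G>: "groebner_complex pair \<nu> red s n e (homogenized_ideal n e I) \<G>"
    and \<C>: "\<C> = {\<sigma> \<in> \<G>. \<sigma> \<subseteq> tropicalization \<nu> I}"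
    using assms(7) unfolding projectively_induced_complex_def by blast
  let ?\<beta> = "residue_ratio t \<tau>"
  note \<beta> = residue_ratio_add[OF \<tau> t] residue_ratio_nonzero[OF \<tau> t]
  have a: "a \<sigma> = (\<lambda>m. ?\<beta> (p \<sigma> m))" for \<sigma>
    by (simp add: assms(10,11) residue_ratio_def fun_eq_iff)
  have face_gammaN: "\<phi> \<subseteq> gammaN pair" if "\<phi> \<in> \<C>" for \<phi>
    using that \<G> by (auto simp: \<C> groebner_complex_def polyhedral_complex_def polyhedron_def)
  have "tropical_reduction \<nu> red \<tau> w I = translate (a \<sigma>) (tropical_reduction \<nu> red t w I)"
    if \<phi>: "\<phi> \<in> \<C>" "w \<in> relint \<phi>" and \<sigma>: "\<sigma> \<in> minimal_faces \<C>" "\<sigma> \<subseteq> \<phi>" for w \<phi> \<sigma>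
  proof -
    have w: "w \<in> \<phi>" "w \<in> gammaN pair"
      using \<phi> face_gammaN by (auto simp: relint_def)
    have p: "p \<sigma> \<in> \<phi>"
      using assms(9) \<sigma> by blast
    \<comment> \<open>The tropical reduction is invariant under the torus point of any difference of points of \<open>\<phi>\<close>.\<close>
    have inv: "scale (\<lambda>m. ?\<beta> (x m - y m)) g \<in> reductions t w I"
      if "x \<in> \<phi>" "y \<in> \<phi>" "g \<in> reductions t w I" for x y g
    proof (rule scale_invariance_gamma_lattice[where L = "linear_lattice pair \<phi>"])
      show "scale (\<lambda>m. c powi pair m u) g \<in> reductions t w I"
        if "u \<in> linear_lattice pair \<phi>" "c \<noteq> 0" "g \<in> reductions t w I" for u c g
        using reductions_graded[OF s I basis \<G> _ \<phi>(2) that(1,2)] \<phi>(1)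
        by (intro scale_invariance_change_section[OF s t _ that(3)]) (auto simp: \<C>)
      show "(\<lambda>m. x m - y m) \<in> gamma_lattice pair (linear_lattice pair \<phi>)"
        using that by (intro difference_in_gamma_lattice[OF face_gammaN[OF \<phi>(1)]])
    qed (use \<beta> that in auto)
    have "g \<in> reductions \<tau> w I \<longleftrightarrow> scale (a \<sigma>) g \<in> reductions t w I" for g
    proof -
      have split: "?\<beta> (x m) = ?\<beta> (x m - y m) * ?\<beta> (y m)" for x y m
        using \<beta>(1)[of "x m - y m" "y m"] by simp
      \<comment> \<open>The points of the torus given by \<open>w\<close> and by \<open>p \<sigma>\<close> differ by that of \<open>w - p \<sigma>\<close>.\<close>
      have *: "scale (\<lambda>m. ?\<beta> (w m)) g = scale (\<lambda>m. ?\<beta> (w m - p \<sigma> m)) (scale (a \<sigma>) g)"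
        "scale (a \<sigma>) g = scale (\<lambda>m. ?\<beta> (p \<sigma> m - w m)) (scale (\<lambda>m. ?\<beta> (w m)) g)"
        unfolding a scale_scale split[symmetric] by (rule refl)+
      have "scale (\<lambda>m. ?\<beta> (w m)) g \<in> reductions t w I \<longleftrightarrow> scale (a \<sigma>) g \<in> reductions t w I"
      proof
        assume "scale (\<lambda>m. ?\<beta> (w m)) g \<in> reductions t w I"
        then show "scale (a \<sigma>) g \<in> reductions t w I"
          unfolding *(2) by (rule inv[OF p w(1)])
      next
        assume "scale (a \<sigma>) g \<in> reductions t w I"
        then show "scale (\<lambda>m. ?\<beta> (w m)) g \<in> reductions t w I"
          unfolding *(1) by (rule inv[OF w(1) p])
      qed
      then show ?thesis
        by (simp only: reductions_change_section[OF \<tau> t, of w g I])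
    qed
    then show ?thesis
      unfolding tropical_reduction_eq_reductions[OF \<tau> w(2) I] tropical_reduction_eq_reductions[OF t w(2) I]
        translate_def by blast
  qed
  moreover have "\<exists>b\<in>torus_points. a ` {\<sigma> \<in> minimal_faces \<C>. \<sigma> \<subseteq> \<rho>} \<subseteq>
      (\<lambda>y m. b m * y m) ` subtorus_points pair (linear_lattice pair \<rho>)" if \<rho>: "\<rho> \<in> \<C>" for \<rho>
  proof (cases "{\<sigma> \<in> minimal_faces \<C>. \<sigma> \<subseteq> \<rho>} = {}")
    case True
    have "(\<lambda>_. 1) \<in> (torus_points :: ('m \<Rightarrow> 'r) set)"
      by (simp add: torus_points_def)
    then show ?thesis
      unfolding True by blast
  next
    case False
    then obtain \<sigma>0 where \<sigma>0: "\<sigma>0 \<in> minimal_faces \<C>" "\<sigma>0 \<subseteq> \<rho>" by blast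
    have p: "p \<sigma> \<in> \<rho>" if "\<sigma> \<in> minimal_faces \<C>" "\<sigma> \<subseteq> \<rho>" for \<sigma>
      using assms(9) that by blast
    have "p \<sigma>0 \<in> gammaN pair"
      using p[OF \<sigma>0] face_gammaN[OF \<rho>] by blast
    then have "a \<sigma>0 \<in> torus_points"
      using \<beta> by (simp add: a torus_points_def gamma_lattice_additive)
    moreover have "a \<sigma> \<in> (\<lambda>y m. a \<sigma>0 m * y m) ` subtorus_points pair (linear_lattice pair \<rho>)"
      if "\<sigma> \<in> minimal_faces \<C>" "\<sigma> \<subseteq> \<rho>" for \<sigma>
    proof (rule image_eqI)
      show "(\<lambda>m. ?\<beta> (p \<sigma> m - p \<sigma>0 m)) \<in> subtorus_points pair (linear_lattice pair \<rho>)"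
        using p[OF that] p[OF \<sigma>0] face_gammaN[OF \<rho>]
        by (intro hom_gamma_lattice_in_subtorus \<beta> difference_in_gamma_lattice)
      show "a \<sigma> = (\<lambda>m. a \<sigma>0 m * ?\<beta> (p \<sigma> m - p \<sigma>0 m))"
        unfolding a \<beta>(1)[symmetric] by simp
    qed
    ultimately show ?thesis by blast
  qed
  ultimately show ?thesis by blast
qed

end
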